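(* Let $\bm A\in\mathbb R^{n\times n}$ be symmetric positive semi-definite, $2\le k\le\operatorname{rank}(\bm A)$, and $p\ge4$. Let $\bm\Omega\in\mathbb R^{n\times(k+p)}$ have i.i.d. $\mathcal N(\bm0,\bm K)$ columns, with $\bm K$ symmetric positive semi-definite such that $\widetilde{\bm K}_{11}$ is invertible, and let $\widehat{\bm A}=\bm A\bm\Omega(\bm\Omega^*\bm A\bm\Omega)^\dagger\bm\Omega^*\bm A$. Define \[ c_1=k\frac{(p-1)(k+1)+2}{p(p-1)(p-3)},\qquad c_2=k\frac{k+p-1}{p(p-1)(p-3)}. \] Then \[ \mathbb E[\|\bm A-\widehat{\bm A}\|_\mathrm F]\le\big(1+2\delta_k^{(\mathrm F)}+2\sqrt{c_1}\beta_k^{(\mathrm F)}\big)\|\bm\Sigma_2\|_\mathrm F+2\sqrt{c_2}\beta_k^{( * )}\|\bm\Sigma_2\|_*. \]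
   Context: Write $\bm A=\bm U\bm\Sigma\bm U^*$ with $\bm U=[\bm U_1\ \bm U_2]$ orthogonal, $\bm U_1\in\mathbb R^{n\times k}$, eigenvalues $\sigma_1\ge\dots\ge\sigma_n\ge0$, $\bm\Sigma_2=\operatorname{diag}(\sigma_{k+1},\dots,\sigma_n)$. Set $\widetilde{\bm K}_{11}=\bm U_1^*\bm K\bm U_1$, $\widetilde{\bm K}_{21}=\bm U_2^*\bm K\bm U_1$, $\widetilde{\bm K}_{22}=\bm U_2^*\bm K\bm U_2$, $\widetilde{\bm K}_{22.1}=\widetilde{\bm K}_{22}-\widetilde{\bm K}_{21}\widetilde{\bm K}_{11}^{-1}\widetilde{\bm K}_{21}^*$. For $\xi\in\{\mathrm F,2,*\}$, $\beta_k^{(\xi)}=\frac{\|\bm\Sigma_2^{1/2}\widetilde{\bm K}_{22.1}\bm\Sigma_2^{1/2}\|_\xi}{\|\bm\Sigma_2\|_\xi}\|\widetilde{\bm K}_{11}^{-1}\|_2$, $\delta_k^{(\xi)}=\frac{\|\bm\Sigma_2^{1/2}\widetilde{\bm K}_{21}\widetilde{\bm K}_{11}^{-2}\widetilde{\bm K}_{21}^*\bm\Sigma_2^{1/2}\|_\xi}{\|\bm\Sigma_2\|_\xi}$. Norms: Frobenius, spectral ($\|\cdot\|_2$), nuclear ($\|\cdot\|_*$); $\dagger$ is the Moore–Penrose pseudoinverse. *)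

theory Defs
  imports "HOL-Probability.Probability"
begin

definition diag_mat :: "('n::finite \<Rightarrow> real) \<Rightarrow> real^'n^'n" where
  "diag_mat f = (\<chi> i j. if i = j then f i else 0)"

definition sym_mat :: "real^'n^'n \<Rightarrow> bool" where
  "sym_mat M \<longleftrightarrow> transpose M = M"

definition psd :: "real^'n^'n \<Rightarrow> bool" where
  "psd M \<longleftrightarrow> sym_mat M \<and> (\<forall>x. 0 \<le> x \<bullet> (M *v x))"

definition psd_sqrt :: "real^'n^'n \<Rightarrow> real^'n^'n" where
  "psd_sqrt M = (THE S. psd S \<and> S ** S = M)"

definition pinv :: "real^'c^'r \<Rightarrow> real^'r^'c" where
  "pinv X = (THE Y. X ** Y ** X = X \<and> Y ** X ** Y = Y \<and>
                    transpose (X ** Y) = X ** Y \<and> transpose (Y ** X) = Y ** X)"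

definition fro_norm :: "real^'c^'r \<Rightarrow> real" where
  "fro_norm X = sqrt (\<Sum>i\<in>UNIV. \<Sum>j\<in>UNIV. (X $ i $ j)\<^sup>2)"

definition spec_norm :: "real^'c^'r \<Rightarrow> real" where
  "spec_norm X = onorm (\<lambda>x. X *v x)"

text \<open>Sum of singular values = trace of (X^T X)^{1/2}.\<close>
definition nuc_norm :: "real^'c^'r \<Rightarrow> real" where
  "nuc_norm X = trace (psd_sqrt (transpose X ** X))"

text \<open>Law of an n x m random matrix with i.i.d. N(0,K) columns: K^{1/2} G with G having
  i.i.d. standard normal entries.\<close>
definition std_gauss_mat :: "(real^'m^'n) measure" where
  "std_gauss_mat = density lborel (\<lambda>G. ennreal (\<Prod>i\<in>UNIV. \<Prod>j\<in>UNIV. std_normal_density (G $ i $ j)))"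

definition gauss_mat :: "real^'n^'n \<Rightarrow> (real^'m^'n) measure" where
  "gauss_mat K = distr std_gauss_mat borel (\<lambda>G. psd_sqrt K ** G)"

definition nystrom :: "real^'n^'n \<Rightarrow> real^'m^'n \<Rightarrow> real^'n^'n" where
  "nystrom A \<Omega> = A ** \<Omega> ** pinv (transpose \<Omega> ** A ** \<Omega>) ** transpose \<Omega> ** A"

text \<open>Blocks with respect to a split of the eigen-index set into S (the top k indices) and
  its complement are represented zero-padded inside n x n matrices.  P S is the coordinate
  projection onto S.\<close>
definition proj :: "'n::finite set \<Rightarrow> real^'n^'n" where
  "proj S = diag_mat (\<lambda>j. if j \<in> S then 1 else 0)"

end

theory Submission
  imports Defs
begin

text \<open>
  For a symmetric square root \<open>H\<close> of \<open>A\<close> the Nystrom error is \<open>H (I - Q) H\<close> with \<open>Q\<close> the orthogonal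
  projection onto the range of \<open>H \<Omega>\<close>, so it is dominated by the Gram matrix of \<open>H - H \<Omega> X\<close> for every \<open>X\<close>.
  With \<open>\<Omega> = K\<^sup>1\<^sup>/\<^sup>2 G\<close>, the rows of \<open>G\<close> split along the rank \<open>k\<close> projection \<open>P\<close> onto the row space of
  \<open>L = U\<^sub>1\<^sup>* K\<^sup>1\<^sup>/\<^sup>2\<close>. For \<open>X\<close> we take a ridge-regularised right inverse of \<open>U\<^sub>1\<^sup>* \<Omega>\<close>, built from
  \<open>R = (P G G\<^sup>* P + e I)\<^sup>-\<^sup>1\<close>, which is a bounded smooth function of \<open>G\<close>; no almost-sure invertibility is needed,
  and the regularisation only costs \<open>O(e)\<close>.

  All expectations come from Gaussian integration by parts \<open>E[G \<bullet> F(G)] = E[div F(G)]\<close>. Applied to \<open>R P G\<close>,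
  \<open>R\<^sup>2 P G\<close> and \<open>tr(P R) R P G\<close>, it yields three linear inequalities between \<open>E tr(P R)\<close>, \<open>E tr(P R\<^sup>2)\<close> and
  \<open>E (tr(P R))\<^sup>2\<close>, in which the terms with \<open>e\<close> have the favourable sign; solving them gives the inverse Wishart
  moments \<open>c\<^sub>1\<close> and \<open>c\<^sub>2\<close>. Applied in the directions orthogonal to \<open>P\<close>, it replaces independence of the two
  parts of \<open>G\<close>.
\<close>

subsection \<open>Matrices with the Frobenius inner product\<close>

text \<open>The shape of the bound comes from splitting the error into blocks. Up to
  \<open>O(e)\<close> the leading block of \<open>H - H \<Omega> X\<close> vanishes and the trailing
  one is \<open>D2 - F\<close> with \<open>F D2 = 0\<close>. Its Gram matrix is
  \<open>Sig2 + F F^T\<close>, so the norm of \<open>Sig2\<close> enters with factor one. Here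
  \<open>F\<close> is, again up to \<open>O(e)\<close>, a deterministic matrix with Gram matrix
  \<open>De\<close> plus a fluctuation \<open>Y La\<close>; separating the two inside
  \<open>F F^T\<close> costs the factors 2. The mean of the norm of \<open>Y Y^T\<close> is bounded
  by the root of its second moment. For \<open>e = 0\<close> that moment is
  \<open>(tr B)^2 E tr V^-2 + |B|^2 (E tr V^-2 + E (tr V^-1)^2)\<close>, with \<open>B\<close> the
  scaled Schur complement and \<open>V\<close> a Wishart matrix of size \<open>k\<close> with
  \<open>k + p\<close> degrees of freedom. The two coefficients are \<open>c2\<close> and
  \<open>c1\<close>, and \<open>tr B\<close> is a nuclear norm because \<open>B\<close> is positive
  semidefinite. The obstacle is that \<open>V^-1\<close> is unbounded near singular matrices, so it
  cannot be inserted directly into an integration by parts that asks for polynomial growth.\<close>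

lemma fro_norm_eq: "fro_norm X = norm X"
  by (simp add: fro_norm_def norm_vec_def L2_set_def sum_nonneg)

lemma inner_mat_def: "(X :: real^'c^'r) \<bullet> Y = (\<Sum>i\<in>UNIV. \<Sum>j\<in>UNIV. X$i$j * Y$i$j)"
  by (simp add: inner_vec_def)

lemma trace_eq_inner: "trace (transpose X ** Y) = (X :: real^'c^'r) \<bullet> Y"
  by (simp add: trace_def matrix_matrix_mult_def transpose_def inner_mat_def) (rule sum.swap)

lemma trace_mat1_inner: "trace X = mat 1 \<bullet> (X :: real^'n^'n)"
  by (metis matrix_mul_lid trace_eq_inner transpose_mat)

lemma inner_transpose: "transpose X \<bullet> transpose Y = (X :: real^'c^'r) \<bullet> Y"
  by (simp add: inner_mat_def transpose_def) (rule sum.swap)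

lemma norm_transpose [simp]: "norm (transpose X) = norm (X :: real^'c^'r)"
  by (simp add: norm_eq_sqrt_inner inner_transpose)

lemma inner_mult_left: "(A ** X) \<bullet> Y = (X :: real^'c^'r) \<bullet> (transpose A ** Y)" for A :: "real^'r^'q"
  by (metis matrix_mul_assoc matrix_transpose_mul trace_eq_inner)

lemma inner_mult_right: "(X ** B) \<bullet> Y = (X :: real^'c^'r) \<bullet> (Y ** transpose B)" for B :: "real^'q^'c"
  by (metis inner_mult_left inner_transpose matrix_transpose_mul)

text \<open>Cauchy-Schwarz for each row-column product; the resulting double sum factorises.\<close>

lemma norm_mult_le: "norm (A ** B) \<le> norm A * norm B" for A :: "real^'m^'n" and B :: "real^'l^'m"
proof (rule power2_le_imp_le)
  have "(norm (A ** B))\<^sup>2 = (\<Sum>i\<in>UNIV. \<Sum>j\<in>UNIV. (A $ i \<bullet> column j B)\<^sup>2)"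
    unfolding power2_norm_eq_inner inner_mat_def
    by (simp add: power2_eq_square matrix_matrix_mult_def inner_vec_def column_def)
  also have "\<dots> \<le> (\<Sum>i\<in>UNIV. \<Sum>j\<in>UNIV. (norm (A $ i))\<^sup>2 * (norm (column j B))\<^sup>2)"
    by (intro sum_mono) (metis Cauchy_Schwarz_ineq power2_norm_eq_inner)
  also have "\<dots> = (\<Sum>i\<in>UNIV. (norm (A $ i))\<^sup>2) * (\<Sum>j\<in>UNIV. (norm (transpose B $ j))\<^sup>2)"
    by (simp add: sum_product column_def transpose_def)
  also have "\<dots> = (norm A)\<^sup>2 * (norm (transpose B))\<^sup>2"
    by (simp add: norm_vec_def[of A] norm_vec_def[of "transpose B"] L2_set_def sum_nonneg del: norm_transpose)
  finally show "(norm (A ** B))\<^sup>2 \<le> (norm A * norm B)\<^sup>2"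
    by (simp add: power_mult_distrib)
qed simp

lemma bounded_bilinear_matrix_mult:
  "bounded_bilinear ((**) :: real^'m^'n \<Rightarrow> real^'l^'m \<Rightarrow> real^'l^'n)"
proof
  show "(a + a') ** b = a ** b + a' ** b" "b'' ** (c + c') = b'' ** c + b'' ** c'" 
    "(r *\<^sub>R a) ** b = r *\<^sub>R (a ** b)"  "a ** (r *\<^sub>R b) = r *\<^sub>R (a ** b)"
    for a a' b'' :: "real^'m^'n" and b c c' :: "real^'l^'m" and r
    by (simp_all add: matrix_matrix_mult_def vec_eq_iff algebra_simps sum.distrib sum_distrib_left)
  show "\<exists>K. \<forall>(a::real^'m^'n) (b::real^'l^'m). norm (a ** b) \<le> norm a * norm b * K"
    by (rule exI[of _ 1]) (simp add: norm_mult_le)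
qed

interpretation matmul: bounded_bilinear "(**) :: real^'m^'n \<Rightarrow> real^'l^'m \<Rightarrow> real^'l^'n"
  by (rule bounded_bilinear_matrix_mult)

lemma bounded_linear_transpose: "bounded_linear (transpose :: real^'c^'r \<Rightarrow> real^'r^'c)"
  by (rule bounded_linear_intro[where K=1]) (auto simp: transpose_def vec_eq_iff norm_transpose[unfolded transpose_def])

lemmas transpose_add = linear_add[OF bounded_linear.linear[OF bounded_linear_transpose]]
  and transpose_diff = linear_diff[OF bounded_linear.linear[OF bounded_linear_transpose]]
  and transpose_scaleR = linear_scale[OF bounded_linear.linear[OF bounded_linear_transpose]]
  and transpose_minus = linear_neg[OF bounded_linear.linear[OF bounded_linear_transpose]]
  and transpose_sum = linear_sum[OF bounded_linear.linear[OF bounded_linear_transpose]]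
  and transpose_0 = linear_0[OF bounded_linear.linear[OF bounded_linear_transpose]]

lemmas mat_simps = matmul.add_left matmul.add_right matmul.diff_left matmul.diff_right
  matmul.scaleR_left matmul.scaleR_right matmul.minus_left matmul.minus_right 
  transpose_add transpose_diff transpose_scaleR transpose_minus matrix_transpose_mul

subsection \<open>Positive semidefinite matrices\<close>

lemma inner_matvec_transpose: "(M *v x) \<bullet> y = x \<bullet> (transpose M *v y)" for M :: "real^'c^'r"
  by (metis dot_lmul_matrix inner_commute transpose_matrix_vector)

lemma psd_sym: "psd M \<Longrightarrow> transpose M = M"
  by (simp add: psd_def sym_mat_def)

lemma psd_ge0: "psd M \<Longrightarrow> 0 \<le> x \<bullet> (M *v x)"
  by (simp add: psd_def)

lemma psdI: "transpose M = M \<Longrightarrow> (\<And>x. 0 \<le> x \<bullet> (M *v x)) \<Longrightarrow> psd M"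
  by (simp add: psd_def sym_mat_def)

lemma psd_0 [simp]: "psd 0"
  by (rule psdI) (simp_all add: transpose_0)

lemma psd_mat1 [simp]: "psd (mat 1)"
  by (rule psdI) (simp_all)

lemma psd_add: "psd A \<Longrightarrow> psd B \<Longrightarrow> psd (A + B)"
  by (rule psdI) (simp_all add: psd_sym transpose_add inner_add_right psd_ge0 matrix_vector_mult_add_rdistrib)

lemma psd_scaleR: "psd A \<Longrightarrow> 0 \<le> c \<Longrightarrow> psd (c *\<^sub>R A)"
  by (rule psdI) (simp_all add: psd_sym transpose_scaleR psd_ge0 scaleR_matrix_vector_assoc[symmetric])

lemma psd_conj: "psd M \<Longrightarrow> psd (transpose X ** M ** X)" for X :: "real^'m^'n"
proof (rule psdI)
  assume M: "psd M"
  show "transpose (transpose X ** M ** X) = transpose X ** M ** X"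
    by (simp add: matrix_transpose_mul psd_sym[OF M] matrix_mul_assoc)
  fix x
  have "x \<bullet> ((transpose X ** M ** X) *v x) = (X *v x) \<bullet> (M *v (X *v x))"
    by (simp add: inner_matvec_transpose matrix_vector_mul_assoc matrix_mul_assoc
        del: transpose_matrix_vector)
  then show "0 \<le> x \<bullet> ((transpose X ** M ** X) *v x)"
    using psd_ge0[OF M] by simp
qed

lemma psd_conj': "psd M \<Longrightarrow> psd (X ** M ** transpose X)" for X :: "real^'m^'n"
  using psd_conj[of M "transpose X"] by simp

lemma psd_gram: "psd (transpose X ** X)" for X :: "real^'m^'n"
  using psd_conj[OF psd_mat1, of X] by simp

lemma psd_gram': "psd (X ** transpose X)" for X :: "real^'m^'n"
  using psd_gram[of "transpose X"] by simp

text \<open>If \<open>w = N v\<close> were nonzero, a small step from \<open>v\<close> along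
  \<open>-w\<close> would make the quadratic form negative, because its change is
  \<open>-2 t |w|^2 + O(t^2)\<close>.\<close>

lemma psd_zero_vec:
  assumes "psd N" "v \<bullet> (N *v v) = 0"
  shows "N *v v = 0"
proof -
  define w where "w = N *v v"
  have vw: "v \<bullet> (N *v w) = w \<bullet> w"
    by (metis assms(1) inner_matvec_transpose psd_sym w_def)
  have vw0: "v \<bullet> w = 0" using assms(2) by (simp add: w_def)
  have *: "0 \<le> - 2 * t * (w \<bullet> w) + t\<^sup>2 * (w \<bullet> (N *v w))" for t
  proof -
    have "0 \<le> (v - t *\<^sub>R w) \<bullet> (N *v (v - t *\<^sub>R w))"
      using assms(1) by (rule psd_ge0)
    also have "\<dots> = - 2 * t * (w \<bullet> w) + t\<^sup>2 * (w \<bullet> (N *v w))"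
      by (simp add: matrix_vector_mult_diff_distrib matrix_vector_mult_scaleR inner_diff_left
          inner_diff_right vw vw0 flip: w_def) (simp add: power2_eq_square algebra_simps)
    finally show ?thesis .
  qed
  have "w \<bullet> w \<le> 0"
  proof (rule ccontr)
    assume "\<not> w \<bullet> w \<le> 0"
    define c where "c = w \<bullet> (N *v w)"
    have c: "0 \<le> c" using psd_ge0[OF assms(1)] c_def by blast
    have p: "w \<bullet> w > 0" using \<open>\<not> w \<bullet> w \<le> 0\<close> by (simp only: not_le)
    \<comment> \<open>With this step length the quadratic term is at most half of the linear one;
      \<open>c + 1\<close> instead of \<open>c\<close> covers the case \<open>c = 0\<close>.\<close>
    define t where "t = (w \<bullet> w) / (c + 1)"
    have t: "t > 0" using p c by (simp add: t_def)
    have "t * c \<le> w \<bullet> w"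
      using p c by (simp add: t_def field_simps)
    then have "t * (t * c) \<le> t * (w \<bullet> w)" using t by simp
    with *[of t] have "0 \<le> - t * (w \<bullet> w)"
      by (simp add: c_def[symmetric] power2_eq_square algebra_simps)
    then show False using mult_pos_pos[OF t p] by simp
  qed
  then show ?thesis using w_def by (metis inner_eq_zero_iff inner_ge_zero order_antisym)
qed

section \<open>Rank-one matrices and the spectral theorem\<close>

definition outer :: "real^'n \<Rightarrow> real^'n^'n" where
  "outer v = (\<chi> i j. v $ i * v $ j)"

lemma outer_vec: "outer v *v x = (v \<bullet> x) *\<^sub>R v"
  by (simp add: outer_def matrix_vector_mult_def vec_eq_iff inner_vec_def sum_distrib_left sum_distrib_right mult_ac)

lemma transpose_outer [simp]: "transpose (outer v) = outer v"
  by (simp add: outer_def transpose_def vec_eq_iff mult.commute)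

lemma psd_outer: "psd (outer v)"
  by (rule psdI) (simp_all add: outer_vec inner_commute)

lemma outer_mult: "outer v ** outer w = (v \<bullet> w) *\<^sub>R (\<chi> i j. v $ i * w $ j)"
  by (simp add: outer_def matrix_matrix_mult_def vec_eq_iff inner_vec_def sum_distrib_left sum_distrib_right mult_ac)

text \<open>Take a maximiser \<open>v\<close> of the quadratic form on the unit sphere, with value
  \<open>\<mu>\<close>. Then \<open>\<mu> I - M\<close> is positive semidefinite and its form
  vanishes at \<open>v\<close>, so it annihilates \<open>v\<close>.\<close>

lemma psd_eigvec:
  fixes M :: "real^'n^'n"
  assumes "psd M" "M \<noteq> 0"
  obtains v \<mu> where "norm v = 1" "\<mu> > 0" "M *v v = \<mu> *\<^sub>R v"
proof -
  have ne: "sphere (0::real^'n) 1 \<noteq> {}" by simp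
  have "continuous_on (sphere 0 1) (\<lambda>x. x \<bullet> (M *v x))"
    by (intro continuous_intros linear_continuous_on_compose[OF continuous_on_id]) auto
  then obtain v where v: "v \<in> sphere 0 1" "\<And>x. x \<in> sphere 0 1 \<Longrightarrow> x \<bullet> (M *v x) \<le> v \<bullet> (M *v v)"
    using continuous_attains_sup[OF compact_sphere ne] by blast
  define \<mu> where "\<mu> = v \<bullet> (M *v v)"
  have nv: "norm v = 1" using v by simp
  have le: "x \<bullet> (M *v x) \<le> \<mu> * (x \<bullet> x)" for x
  proof (cases "x = 0")
    case False
    have "(x /\<^sub>R norm x) \<bullet> (M *v (x /\<^sub>R norm x)) \<le> \<mu>"
      unfolding \<mu>_def by (rule v) (simp add: False)
    then have "(x \<bullet> (M *v x)) / (norm x)\<^sup>2 \<le> \<mu>"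
      by (simp add: matrix_vector_mult_scaleR power2_eq_square divide_inverse mult_ac)
    then show ?thesis using False by (simp add: field_simps power2_norm_eq_inner)
  qed simp
  define N where "N = \<mu> *\<^sub>R mat 1 - M"
  have Nv: "N *v x = \<mu> *\<^sub>R x - M *v x" for x
    by (simp add: N_def matrix_vector_mult_diff_rdistrib scaleR_matrix_vector_assoc[symmetric])
  have "psd N"
    by (rule psdI) (simp add: N_def transpose_diff transpose_scaleR psd_sym[OF assms(1)],
        simp add: Nv inner_diff_right le)
  moreover have "v \<bullet> (N *v v) = 0"
    using nv by (simp add: Nv inner_diff_right \<mu>_def[symmetric] norm_eq_1)
  ultimately have "N *v v = 0" by (rule psd_zero_vec)
  then have ev: "M *v v = \<mu> *\<^sub>R v" by (simp add: Nv)
  have "\<mu> > 0"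
  proof (rule ccontr)
    assume "\<not> \<mu> > 0"
    then have "x \<bullet> (M *v x) = 0" for x
      using le[of x] psd_ge0[OF assms(1), of x] mult_nonpos_nonneg[of \<mu> "x \<bullet> x"] by simp
    then have "M *v x = 0" for x using psd_zero_vec[OF assms(1)] by blast
    then have "M = 0" by (simp add: matrix_eq)
    with assms show False by simp
  qed
  with that nv ev show thesis by blast
qed

text \<open>Deflation: removing the rank-one part of a unit eigenvector keeps the matrix positive
  semidefinite and lowers its rank. Only positive eigenvalues are listed, so \<open>B\<close> spans
  the range of \<open>M\<close> and may be empty.\<close>

lemma psd_spectral:
  fixes M :: "real^'n^'n"
  assumes "psd M"
  shows "\<exists>B \<mu>. finite B \<and> (\<forall>v\<in>B. norm v = 1) \<and> (\<forall>v\<in>B. \<mu> v > 0)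
     \<and> pairwise orthogonal B \<and> M = (\<Sum>v\<in>B. \<mu> v *\<^sub>R outer v)"
proof -
  \<comment> \<open>The eigenvector equations are carried through the induction because they make
    each new vector orthogonal to the earlier ones.\<close>
  have "\<exists>B \<mu>. finite B \<and> (\<forall>v\<in>B. norm v = 1 \<and> \<mu> v > 0 \<and> M *v v = \<mu> v *\<^sub>R v)
     \<and> pairwise orthogonal B \<and> M = (\<Sum>v\<in>B. \<mu> v *\<^sub>R outer v)"
    using assms
  proof (induction "rank M" arbitrary: M rule: less_induct)
    case less
    show ?case
    proof (cases "M = 0")
      case True then show ?thesis by (intro exI[of _ "{}"]) simp
    next
      case False
      obtain v \<mu>0 where v: "norm v = 1" "\<mu>0 > 0" "M *v v = \<mu>0 *\<^sub>R v"
        using psd_eigvec[OF less.prems False] .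
      have vv: "v \<bullet> v = 1" using v(1) by (simp add: norm_eq_1)
      define M' where "M' = M - \<mu>0 *\<^sub>R outer v"
      have M'x: "M' *v x = M *v x - (\<mu>0 * (v \<bullet> x)) *\<^sub>R v" for x
        by (simp add: M'_def matrix_vector_mult_diff_rdistrib scaleR_matrix_vector_assoc[symmetric] outer_vec)
      have M'v: "M' *v v = 0" by (simp add: M'x v vv)
      have vMx: "v \<bullet> (M *v x) = \<mu>0 * (v \<bullet> x)" for x
        by (metis inner_commute inner_matvec_transpose inner_scaleR_right less.prems psd_sym v(3))
      have psd': "psd M'"
      proof (rule psdI)
        show "transpose M' = M'" by (simp add: M'_def transpose_diff transpose_scaleR psd_sym[OF less.prems])
        fix x
        \<comment> \<open>\<open>y\<close> is the component of \<open>x\<close> orthogonal to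
          \<open>v\<close>: the deflated form at \<open>x\<close> is the original form at
          \<open>y\<close>.\<close>
        define y where "y = x - (v \<bullet> x) *\<^sub>R v"
        have "y \<bullet> (M *v y) = x \<bullet> (M' *v x)"
          unfolding y_def
          by (simp add: M'x matrix_vector_mult_diff_distrib matrix_vector_mult_scaleR v(3) inner_diff_left
              inner_diff_right vMx vv) (simp add: inner_commute)
        then show "0 \<le> x \<bullet> (M' *v x)" using psd_ge0[OF less.prems, of y] by simp
      qed
      \<comment> \<open>Strictness is witnessed by \<open>v\<close>: it lies in the range of
        \<open>M\<close>, but not in that of the symmetric matrix \<open>M'\<close>, which
        annihilates it.\<close>
      have sub: "range ((*v) M') \<subset> range ((*v) M)"
      proof
        have "M' *v x = M *v (x - (v \<bullet> x) *\<^sub>R v)" for x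
          by (simp add: M'x matrix_vector_mult_diff_distrib matrix_vector_mult_scaleR v(3) mult.commute)
        then show "range ((*v) M') \<subseteq> range ((*v) M)" by auto
        have "v = M *v (v /\<^sub>R \<mu>0)" using v by (simp add: matrix_vector_mult_scaleR)
        then have "v \<in> range ((*v) M)" by (rule range_eqI)
        moreover have "v \<notin> range ((*v) M')"
        proof
          assume "v \<in> range ((*v) M')"
          then obtain x where "v = M' *v x" by auto
          then have "v \<bullet> v = x \<bullet> (M' *v v)"
            by (metis inner_matvec_transpose psd' psd_sym)
          then show False using vv M'v by simp
        qed
        ultimately show "range ((*v) M') \<noteq> range ((*v) M)" by blast
      qed
      have lin: "subspace (range ((*v) M'))" "subspace (range ((*v) M))"
        by (auto intro: linear_subspace_image)
      have "rank M' < rank M"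
        unfolding rank_dim_range using sub lin by (intro dim_psubset) (metis span_eq_iff)
      from less.hyps[OF this psd'] obtain B \<mu>
        where B: "finite B" "\<forall>v\<in>B. norm v = 1 \<and> \<mu> v > 0 \<and> M' *v v = \<mu> v *\<^sub>R v"
          "pairwise orthogonal B" "M' = (\<Sum>v\<in>B. \<mu> v *\<^sub>R outer v)" by auto
      have orth: "v \<bullet> w = 0" if "w \<in> B" for w
      proof -
        have "\<mu> w * (v \<bullet> w) = v \<bullet> (M' *v w)" using B(2) that by simp
        also have "\<dots> = (M' *v v) \<bullet> w" by (metis inner_matvec_transpose psd' psd_sym)
        finally show ?thesis using B(2) that M'v by fastforce
      qed
      have nB: "v \<notin> B" using orth[of v] vv by auto
      have Mw: "M *v w = \<mu> w *\<^sub>R w" if "w \<in> B" for w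
        using M'x[of w] orth[OF that] B(2) that by simp
      show ?thesis
      proof (intro exI[of _ "insert v B"] exI[of _ "\<mu>(v := \<mu>0)"] conjI)
        show "finite (insert v B)" using B by simp
        show "\<forall>w\<in>insert v B. norm w = 1 \<and> 0 < (\<mu>(v := \<mu>0)) w \<and> M *v w = (\<mu>(v := \<mu>0)) w *\<^sub>R w"
          using v B Mw by auto
        show "pairwise orthogonal (insert v B)"
          using B(3) orth by (auto simp: pairwise_insert orthogonal_def inner_commute)
        have "(\<Sum>w\<in>B. (\<mu>(v := \<mu>0)) w *\<^sub>R outer w) = (\<Sum>w\<in>B. \<mu> w *\<^sub>R outer w)"
          using nB by (intro sum.cong) auto
        then show "M = (\<Sum>w\<in>insert v B. (\<mu>(v := \<mu>0)) w *\<^sub>R outer w)"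
          using nB B(1) B(4) by (simp add: M'_def algebra_simps)
      qed
    qed
  qed
  then show ?thesis by blast
qed

text \<open>Functional calculus on an orthonormal family. Roots of the coefficients yield matrix
  square roots, reciprocals yield pseudoinverses.\<close>

lemma spectral_mult:
  assumes "finite B" "\<forall>v\<in>B. norm v = 1" "pairwise orthogonal B"
  shows "(\<Sum>v\<in>B. f v *\<^sub>R outer v) ** (\<Sum>v\<in>B. g v *\<^sub>R outer v) = (\<Sum>v\<in>B. (f v * g v) *\<^sub>R outer v)"
proof -
  have *: "outer v ** outer w = (if w = v then outer v else 0)" if "v \<in> B" "w \<in> B" for v w
  proof (cases "w = v")
    case True
    then have "v \<bullet> w = 1" using assms(2) that by (simp add: norm_eq_1)
    then show ?thesis using True by (simp add: outer_mult) (simp add: outer_def)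
  next
    case False
    then have "v \<bullet> w = 0" using assms(3) that by (auto simp: pairwise_def orthogonal_def)
    then show ?thesis using False by (simp add: outer_mult)
  qed
  have "(\<Sum>v\<in>B. f v *\<^sub>R outer v) ** (\<Sum>v\<in>B. g v *\<^sub>R outer v)
      = (\<Sum>v\<in>B. \<Sum>w\<in>B. (f v * g w) *\<^sub>R (outer v ** outer w))"
    unfolding matmul.sum_left matmul.sum_right by (subst sum.swap) (simp add: mat_simps mult.commute)
  also have "\<dots> = (\<Sum>v\<in>B. \<Sum>w\<in>B. if w = v then (f v * g v) *\<^sub>R outer v else 0)"
    by (intro sum.cong refl) (auto simp: *)
  finally show ?thesis using assms(1) by simp
qed

lemma psd_spectral_sum: "(\<And>v. v \<in> B \<Longrightarrow> 0 \<le> f v) \<Longrightarrow> psd (\<Sum>v\<in>B. f v *\<^sub>R outer v)"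
  by (induction B rule: infinite_finite_induct) (auto intro!: psd_add psd_scaleR psd_outer)

text \<open>Expanding \<open>A\<close> spectrally turns the inner product into a positive
  combination of the numbers \<open>v . (B v)\<close>.\<close>

lemma psd_inner_nonneg:
  assumes "psd A" "psd B"
  shows "0 \<le> A \<bullet> B"
proof -
  obtain C \<mu> where C: "\<forall>v\<in>C. \<mu> v > 0" "A = (\<Sum>v\<in>C. \<mu> v *\<^sub>R outer v)"
    using psd_spectral[OF assms(1)] by blast
  have "outer v \<bullet> B = v \<bullet> (B *v v)" for v
    by (simp add: inner_mat_def outer_def matrix_vector_mult_def inner_vec_def sum_distrib_left mult_ac)
  then have "0 \<le> (\<mu> v *\<^sub>R outer v) \<bullet> B" if "v \<in> C" for v
    using C(1) that psd_ge0[OF assms(2), of v] by (simp add: less_imp_le)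
  then show ?thesis unfolding C(2) inner_sum_left by (intro sum_nonneg) simp
qed

text \<open>In \<open>|Y|^2 = |X|^2 + 2 X . (Y - X) + |Y - X|^2\<close> the mixed term pairs two
  positive semidefinite matrices. All comparisons of error matrices below go through this
  monotonicity.\<close>

lemma psd_norm_mono:
  assumes "psd X" "psd (Y - X)"
  shows "norm X \<le> norm Y"
proof (rule power2_le_imp_le)
  have "Y \<bullet> Y = X \<bullet> X + 2 * (X \<bullet> (Y - X)) + (Y - X) \<bullet> (Y - X)"
    by (simp add: inner_diff_left inner_diff_right inner_commute)
  then show "(norm X)\<^sup>2 \<le> (norm Y)\<^sup>2"
    using psd_inner_nonneg[OF assms] by (simp add: power2_norm_eq_inner)
qed simp

lemma psd_trace_nonneg: "psd M \<Longrightarrow> 0 \<le> trace M"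
  unfolding trace_mat1_inner by (rule psd_inner_nonneg) simp_all

lemma psd_trace_eq_0:
  assumes "psd M" "trace M = 0" shows "M = 0"
proof -
  have "M $ i $ i = axis i 1 \<bullet> (M *v axis i 1)" for i
    by (simp add: inner_axis' matrix_vector_mult_basis column_def)
  then have nn: "0 \<le> M $ i $ i" for i using psd_ge0[OF assms(1)] by simp
  have "M $ i $ i = 0" for i
    using assms(2) nn unfolding trace_def by (simp add: sum_nonneg_eq_0_iff)
  then have "axis i 1 \<bullet> (M *v axis i 1) = 0" for i
    by (simp add: inner_axis' matrix_vector_mult_basis column_def)
  then have "M *v axis i 1 = 0" for i using psd_zero_vec[OF assms(1)] by blast
  then have "column i M = 0" for i by (simp add: matrix_vector_mult_basis)
  then show ?thesis by (simp add: column_def vec_eq_iff)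
qed

lemma gram_eq_0: "transpose X ** X = 0 \<Longrightarrow> X = 0" for X :: "real^'m^'n"
proof -
  assume "transpose X ** X = 0"
  then have "X \<bullet> X = 0" by (metis trace_eq_inner trace_0 mat_0)
  then show "X = 0" by simp
qed

lemma trace_neg: "trace (- A) = - trace (A :: real^'n^'n)"
  by (simp add: trace_def sum_negf)

text \<open>The difference \<open>D = S - T\<close> anticommutes with \<open>S + T\<close>, so the
  trace of \<open>D (S + T) D\<close> equals its own negative. Hence \<open>D S D\<close> and
  \<open>D T D\<close>, positive semidefinite with total trace zero, both vanish, and so does their
  difference \<open>D^3\<close>; as \<open>D\<close> is symmetric, \<open>D = 0\<close>.\<close>

lemma psd_square_unique:
  assumes "psd S" "psd T" "S ** S = T ** T"
  shows "S = T"
proof -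
  define D where "D = S - T"
  have D: "transpose D = D" by (simp add: D_def transpose_diff psd_sym assms)
  have anti: "D ** (S + T) + (S + T) ** D = 0"
    using assms(3) by (simp add: D_def mat_simps)
  have "D ** (S + T) = - ((S + T) ** D)"
    using anti by (simp only: eq_neg_iff_add_eq_0)
  then have "D ** (S + T) ** D = - ((S + T) ** (D ** D))"
    by (simp only: matmul.minus_left matrix_mul_assoc)
  then have "trace (D ** (S + T) ** D) = - trace ((D ** D) ** (S + T))"
    by (simp only: trace_neg trace_mul_sym[of "S + T" "D ** D"])
  moreover have "trace (D ** (S + T) ** D) = trace ((D ** D) ** (S + T))"
    by (simp only: trace_mul_sym[of "D ** (S + T)" D] matrix_mul_assoc)
  ultimately have tr0: "trace (D ** (S + T) ** D) = 0" by linarith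
  have pS: "psd (D ** S ** D)" and pT: "psd (D ** T ** D)"
    using psd_conj[OF assms(1), of D] psd_conj[OF assms(2), of D] unfolding D by blast+
  have "trace (D ** S ** D) + trace (D ** T ** D) = 0"
    using tr0 by (simp add: mat_simps trace_add)
  then have "trace (D ** S ** D) = 0" "trace (D ** T ** D) = 0"
    using psd_trace_nonneg[OF pS] psd_trace_nonneg[OF pT] by linarith+
  then have "D ** S ** D = 0" "D ** T ** D = 0"
    using pS pT psd_trace_eq_0 by blast+
  then have "D ** S ** D - D ** T ** D = 0" by simp
  then have "D ** D ** D = 0"
    by (simp add: D_def[symmetric] matmul.diff_left[symmetric] matmul.diff_right[symmetric])
  then have "transpose (D ** D) ** (D ** D) = 0"
    by (simp add: matrix_transpose_mul D matrix_mul_assoc matmul.zero_left)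
  then have "D ** D = 0" by (rule gram_eq_0)
  then have "transpose D ** D = 0" by (simp add: D)
  then have "D = 0" by (rule gram_eq_0)
  then show ?thesis by (simp add: D_def)
qed

lemma psd_sqrt_unique: "psd S \<Longrightarrow> S ** S = M \<Longrightarrow> psd_sqrt M = S"
  unfolding psd_sqrt_def by (rule the_equality) (auto intro: psd_square_unique)

lemma psd_sqrt:
  assumes "psd M" 
  shows "psd (psd_sqrt M)" "psd_sqrt M ** psd_sqrt M = M"
proof -
  obtain C \<mu> where C: "finite C" "\<forall>v\<in>C. norm v = 1" "\<forall>v\<in>C. \<mu> v > 0"
    "pairwise orthogonal C" "M = (\<Sum>v\<in>C. \<mu> v *\<^sub>R outer v)"
    using psd_spectral[OF assms(1)] by blast
  define S where "S = (\<Sum>v\<in>C. sqrt (\<mu> v) *\<^sub>R outer v)"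
  have "psd S" unfolding S_def by (rule psd_spectral_sum) (use C(3) in \<open>simp add: less_imp_le\<close>)
  moreover have "S ** S = M"
    unfolding S_def spectral_mult[OF C(1,2,4)] C(5) using C(3)
    by (intro sum.cong) (auto simp: less_imp_le)
  ultimately show "psd (psd_sqrt M)" "psd_sqrt M ** psd_sqrt M = M"
    using psd_sqrt_unique[of S M] by auto
qed

text \<open>A positive semidefinite \<open>M\<close> is itself the square root of
  \<open>M^T M\<close>. This is how traces become the nuclear norms of the final bound.\<close>

lemma nuc_norm_psd: "psd M \<Longrightarrow> nuc_norm M = trace M"
  by (simp add: nuc_norm_def psd_sym psd_sqrt_unique)

subsection \<open>The Moore--Penrose pseudoinverse\<close>

definition is_pinv :: "real^'c^'r \<Rightarrow> real^'r^'c \<Rightarrow> bool" where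
  "is_pinv X Y \<longleftrightarrow> X ** Y ** X = X \<and> Y ** X ** Y = Y \<and>
                    transpose (X ** Y) = X ** Y \<and> transpose (Y ** X) = Y ** X"

lemma is_pinv_unique:
  assumes "is_pinv X Y" "is_pinv X Z" shows "Y = Z"
proof -
  have XY: "X ** Y = X ** Z"
  proof -
    have "X ** Y = transpose (X ** Z ** X ** Y)" using assms by (simp add: is_pinv_def)
    also have "\<dots> = transpose (X ** Y) ** transpose (X ** Z)" 
      by (simp add: matrix_transpose_mul matrix_mul_assoc)
    also have "\<dots> = X ** Y ** X ** Z" using assms by (simp add: is_pinv_def matrix_mul_assoc)
    finally show ?thesis using assms by (simp add: is_pinv_def)
  qed
  have YX: "Y ** X = Z ** X"
  proof -
    have "X = X ** Z ** X" using assms by (simp add: is_pinv_def)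
    then have "Y ** X = transpose (Y ** (X ** Z ** X))" using assms(1) unfolding is_pinv_def by metis
    also have "\<dots> = transpose (Z ** X) ** transpose (Y ** X)" 
      by (simp add: matrix_transpose_mul matrix_mul_assoc)
    also have "\<dots> = Z ** (X ** Y ** X)" using assms unfolding is_pinv_def by (metis matrix_mul_assoc)
    also have "X ** Y ** X = X" using assms by (simp add: is_pinv_def)
    finally show ?thesis .
  qed
  have "Y = Y ** (X ** Y)" using assms by (simp add: is_pinv_def matrix_mul_assoc)
  also have "\<dots> = Z ** X ** Z" by (simp add: XY matrix_mul_assoc YX)
  also have "\<dots> = Z" using assms by (simp add: is_pinv_def)
  finally show ?thesis .
qed

lemma pinv_eqI: "is_pinv X Y \<Longrightarrow> pinv X = Y"
  unfolding pinv_def is_pinv_def[symmetric] by (rule the_equality) (auto intro: is_pinv_unique)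

text \<open>Inverting the positive eigenvalues in the spectral sum satisfies the four Penrose
  equations. Both products with \<open>M\<close> are the orthogonal projection onto its range, hence
  they agree.\<close>

lemma pinv_psd:
  assumes "psd M"
  shows "M ** pinv M ** M = M" "pinv M ** M ** pinv M = pinv M" "transpose (pinv M) = pinv M"
    "M ** pinv M = pinv M ** M"
proof -
  obtain C \<mu> where C: "finite C" "\<forall>v\<in>C. norm v = 1" "\<forall>v\<in>C. \<mu> v > 0"
    "pairwise orthogonal C" "M = (\<Sum>v\<in>C. \<mu> v *\<^sub>R outer v)"
    using psd_spectral[OF assms(1)] by blast
  define Y where "Y = (\<Sum>v\<in>C. inverse (\<mu> v) *\<^sub>R outer v)"
  have nz: "\<mu> v \<noteq> 0" if "v \<in> C" for v using C(3) that by auto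
  have MY: "M ** Y = (\<Sum>v\<in>C. 1 *\<^sub>R outer v)" and YM: "Y ** M = (\<Sum>v\<in>C. 1 *\<^sub>R outer v)"
    unfolding Y_def C(5) by (subst spectral_mult[OF C(1,2,4)]; auto intro!: sum.cong simp: nz)+
  have pv: "is_pinv M Y" unfolding is_pinv_def MY YM
    unfolding C(5) Y_def by (simp only: spectral_mult[OF C(1,2,4)]) (simp add: transpose_sum)
  note eq = pinv_eqI[OF pv]
  show "M ** pinv M ** M = M" "pinv M ** M ** pinv M = pinv M"
    using pv by (simp_all add: eq is_pinv_def)
  show "transpose (pinv M) = pinv M"
    unfolding eq by (simp add: Y_def transpose_sum transpose_scaleR)
  show "M ** pinv M = pinv M ** M"
    unfolding eq MY YM ..
qed

subsection \<open>Functions of polynomial growth\<close>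

text \<open>Continuity provides measurability and the growth bound provides Gaussian integrability.
  The class is closed under sums and bounded bilinear maps, so integrability obligations reduce to
  the rules \<open>pg_intros\<close>.\<close>

definition poly_growth :: "('a::real_normed_vector \<Rightarrow> 'b::real_normed_vector) \<Rightarrow> bool" where
  "poly_growth f \<longleftrightarrow> continuous_on UNIV f \<and> (\<exists>C N. \<forall>x. norm (f x) \<le> C * (1 + norm x) ^ N)"

named_theorems pg_intros

lemma poly_growthI: "continuous_on UNIV f \<Longrightarrow> (\<And>x. norm (f x) \<le> C * (1 + norm x) ^ N) \<Longrightarrow> poly_growth f"
  by (auto simp: poly_growth_def)

lemma poly_growth_cont: "poly_growth f \<Longrightarrow> continuous_on UNIV f"
  by (simp add: poly_growth_def)

lemma poly_growthE:
  assumes "poly_growth f"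
  obtains C N where "C \<ge> (0::real)" "\<And>x. norm (f x) \<le> C * (1 + norm x) ^ N"
proof -
  obtain C N where CN: "\<And>x. norm (f x) \<le> C * (1 + norm x) ^ N"
    using assms by (auto simp: poly_growth_def)
  have "0 \<le> C" using order_trans[OF norm_ge_zero CN[of 0]] by simp
  with CN that show thesis by blast
qed

lemma poly_growth_const [pg_intros]: "poly_growth (\<lambda>x. c)"
  by (rule poly_growthI[where C="norm c" and N=0]) auto

lemma poly_growth_id [pg_intros]: "poly_growth (\<lambda>x. x)"
  by (rule poly_growthI[where C=1 and N=1]) (auto intro: continuous_intros)

lemma poly_growth_add [pg_intros]:
  fixes f g :: "'a::real_normed_vector \<Rightarrow> 'b::real_normed_vector"
  assumes "poly_growth f" "poly_growth g" shows "poly_growth (\<lambda>x. f x + g x)"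
proof -
  obtain C N where C: "C \<ge> (0::real)" "\<And>x. norm (f x) \<le> C * (1 + norm x) ^ N" using poly_growthE[OF assms(1)] by blast
  obtain D M where D: "D \<ge> 0" "\<And>x. norm (g x) \<le> D * (1 + norm x) ^ M" using poly_growthE[OF assms(2)] by blast
  show ?thesis
  proof (rule poly_growthI)
    show "continuous_on UNIV (\<lambda>x. f x + g x)" using assms by (intro continuous_intros poly_growth_cont)
    fix x :: 'a
    have "C * (1 + norm x) ^ N \<le> C * (1 + norm x) ^ (N + M)"
      using C(1) by (intro mult_left_mono power_increasing) auto
    moreover have "D * (1 + norm x) ^ M \<le> D * (1 + norm x) ^ (N + M)"
      using D(1) by (intro mult_left_mono power_increasing) auto
    ultimately show "norm (f x + g x) \<le> (C + D) * (1 + norm x) ^ (N + M)"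
      using C(2)[of x] D(2)[of x] norm_triangle_ineq[of "f x" "g x"] by (simp add: distrib_right)
  qed
qed

lemma poly_growth_linear:
  fixes f :: "'a::real_normed_vector \<Rightarrow> 'b::real_normed_vector" and L :: "'b \<Rightarrow> 'c::real_normed_vector"
  assumes "bounded_linear L" "poly_growth f" shows "poly_growth (\<lambda>x. L (f x))"
proof -
  obtain C N where C: "C \<ge> (0::real)" "\<And>x. norm (f x) \<le> C * (1 + norm x) ^ N" using poly_growthE[OF assms(2)] by blast
  obtain K where K: "0 \<le> K" "\<And>x. norm (L x) \<le> norm x * K" using bounded_linear.nonneg_bounded[OF assms(1)] by blast
  show ?thesis
  proof (rule poly_growthI)
    show "continuous_on UNIV (\<lambda>x. L (f x))"
      by (rule bounded_linear.continuous_on[OF assms(1) poly_growth_cont[OF assms(2)]])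
    fix x
    have "norm (L (f x)) \<le> norm (f x) * K" by (rule K)
    also have "\<dots> \<le> (C * (1 + norm x) ^ N) * K" using K(1) C(2)[of x] by (rule mult_right_mono[rotated])
    finally show "norm (L (f x)) \<le> (C * K) * (1 + norm x) ^ N" by (simp add: mult_ac)
  qed
qed

lemma poly_growth_bilinear:
  fixes f :: "'d::real_normed_vector \<Rightarrow> 'a::real_normed_vector" and g :: "'d \<Rightarrow> 'b::real_normed_vector"
    and B :: "'a \<Rightarrow> 'b \<Rightarrow> 'c::real_normed_vector"
  assumes "bounded_bilinear B" "poly_growth f" "poly_growth g" shows "poly_growth (\<lambda>x. B (f x) (g x))"
proof -
  obtain C N where C: "C \<ge> (0::real)" "\<And>x. norm (f x) \<le> C * (1 + norm x) ^ N" using poly_growthE[OF assms(2)] by blast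
  obtain D M where D: "D \<ge> 0" "\<And>x. norm (g x) \<le> D * (1 + norm x) ^ M" using poly_growthE[OF assms(3)] by blast
  obtain K where K: "0 \<le> K" "\<And>a b. norm (B a b) \<le> norm a * norm b * K"
    using bounded_bilinear.nonneg_bounded[OF assms(1)] by blast
  show ?thesis
  proof (rule poly_growthI)
    show "continuous_on UNIV (\<lambda>x. B (f x) (g x))"
      by (rule bounded_bilinear.continuous_on[OF assms(1) poly_growth_cont[OF assms(2)] poly_growth_cont[OF assms(3)]])
    fix x
    have "norm (B (f x) (g x)) \<le> norm (f x) * norm (g x) * K" by (rule K)
    also have "\<dots> \<le> (C * (1 + norm x) ^ N) * (D * (1 + norm x) ^ M) * K"
      using K(1) C D by (intro mult_right_mono mult_mono) auto
    finally show "norm (B (f x) (g x)) \<le> (C * D * K) * (1 + norm x) ^ (N + M)"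
      by (simp add: mult_ac power_add)
  qed
qed

lemmas poly_growth_minus [pg_intros] = poly_growth_linear[OF bounded_linear_minus[OF bounded_linear_ident]]
  and poly_growth_mult [pg_intros] = poly_growth_bilinear[OF bounded_bilinear_mult]
  and poly_growth_scaleR [pg_intros] = poly_growth_bilinear[OF bounded_bilinear_scaleR]
  and poly_growth_inner [pg_intros] = poly_growth_bilinear[OF bounded_bilinear_inner]
  and poly_growth_matmul [pg_intros] = poly_growth_bilinear[OF bounded_bilinear_matrix_mult]
  and poly_growth_transpose [pg_intros] = poly_growth_linear[OF bounded_linear_transpose]

lemma poly_growth_diff [pg_intros]: "poly_growth f \<Longrightarrow> poly_growth g \<Longrightarrow> poly_growth (\<lambda>x. f x - g x)"
  using poly_growth_add[OF _ poly_growth_minus, of f g] by simp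

lemma poly_growth_power [pg_intros]: "poly_growth f \<Longrightarrow> poly_growth (\<lambda>x. f x ^ n :: real)"
  by (induction n) (auto intro: pg_intros)

lemma poly_growth_norm [pg_intros]:
  assumes "poly_growth f" shows "poly_growth (\<lambda>x. norm (f x))"
  using assms unfolding poly_growth_def by (auto intro: continuous_on_norm)

lemma poly_growth_trace [pg_intros]: "poly_growth f \<Longrightarrow> poly_growth (\<lambda>x. trace (f x) :: real)"
  unfolding trace_mat1_inner by (intro pg_intros)

lemma poly_growth_borel: "poly_growth f \<Longrightarrow> f \<in> borel_measurable borel"
  by (rule borel_measurable_continuous_onI[OF poly_growth_cont])

subsection \<open>The standard Gaussian measure\<close>

definition gauss_density :: "'a::euclidean_space \<Rightarrow> real" where
  "gauss_density x = (\<Prod>b\<in>Basis. std_normal_density (x \<bullet> b))"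

definition gauss :: "'a::euclidean_space measure" where
  "gauss = density lborel (\<lambda>x. ennreal (gauss_density x))"

lemma gauss_density_eq:
  "gauss_density (x :: 'a::euclidean_space) = (1 / sqrt (2 * pi)) ^ DIM('a) * exp (- (x \<bullet> x) / 2)"
proof -
  have "gauss_density x = (1 / sqrt (2 * pi)) ^ DIM('a) * (\<Prod>b\<in>Basis. exp (- (x \<bullet> b)\<^sup>2 / 2))"
    by (simp add: gauss_density_def std_normal_density_def prod_dividef power_one_over field_simps)
  also have "(\<Prod>b\<in>Basis. exp (- (x \<bullet> b)\<^sup>2 / 2)) = exp (\<Sum>b\<in>Basis. - (x \<bullet> b)\<^sup>2 / 2)"
    by (rule exp_sum[symmetric]) simp
  also have "(\<Sum>b\<in>Basis. - (x \<bullet> b)\<^sup>2 / 2) = - (x \<bullet> x) / 2"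
    by (subst euclidean_inner) (simp add: sum_negf sum_divide_distrib power2_eq_square)
  finally show ?thesis .
qed

lemma gauss_density_nonneg: "0 \<le> gauss_density x"
  by (simp add: gauss_density_eq)

lemma continuous_gauss_density: "continuous_on UNIV gauss_density"
  unfolding gauss_density_eq by (intro continuous_intros) auto

lemma gauss_density_borel [measurable]: "gauss_density \<in> borel_measurable borel"
  by (rule borel_measurable_continuous_onI[OF continuous_gauss_density])

lemma sets_gauss [simp, measurable_cong]: "sets gauss = sets borel"
  and space_gauss [simp]: "space gauss = UNIV"
  by (simp_all add: gauss_def)

lemma prob_space_gauss: "prob_space gauss"
proof
  have "emeasure gauss (space (gauss :: 'a measure)) = (\<integral>\<^sup>+x. (\<Prod>b\<in>Basis. ennreal (std_normal_density (x \<bullet> b))) \<partial>(lborel :: 'a measure))"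
    by (simp add: gauss_def emeasure_density gauss_density_def prod_ennreal)
  also have "\<dots> = (\<Prod>b\<in>(Basis::'a set). (\<integral>\<^sup>+x. ennreal (std_normal_density x) \<partial>lborel))"
    by (rule nn_integral_lborel_prod) auto
  also have "(\<integral>\<^sup>+x. ennreal (std_normal_density x) \<partial>lborel) = 1"
    using prob_space.emeasure_space_1[OF prob_space_normal_density[of 1 0]]
    by (simp add: emeasure_density)
  finally show "emeasure gauss (space (gauss :: 'a measure)) = 1" by simp
qed

interpretation gauss: prob_space "gauss :: 'a::euclidean_space measure"
  by (rule prob_space_gauss)

text \<open>One term of the exponential series is at most the whole series.\<close>

lemma power_le_fact_exp: "0 \<le> y \<Longrightarrow> y ^ n \<le> fact n * exp (y::real)"
proof -
  assume y: "0 \<le> y"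
  have "(\<Sum>k\<in>{n}. y ^ k /\<^sub>R fact k) \<le> (\<Sum>k. y ^ k /\<^sub>R fact k)"
    using y by (intro sum_le_suminf sums_summable[OF exp_converges]) auto
  then show ?thesis by (simp add: exp_def field_simps)
qed

lemma integrable_exp_square:
  "integrable lborel (\<lambda>x::'a::euclidean_space. exp (- (x \<bullet> x) / 8))"
proof -
  have eq: "exp (- (x \<bullet> x) / 8) = (\<Prod>b\<in>Basis. exp (- (x \<bullet> b)\<^sup>2 / 8))" for x :: 'a
    by (subst euclidean_inner) (simp add: exp_sum[symmetric] sum_negf sum_divide_distrib power2_eq_square)
  have nd: "exp (- y\<^sup>2 / 8) = sqrt (8 * pi) * normal_density 0 2 y" for y :: real
    by (simp add: normal_density_def)
  have "integrable lborel (\<lambda>y::real. exp (- y\<^sup>2 / 8))"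
    unfolding nd by (intro integrable_mult_right integrable_normal_density) simp
  then have fin: "(\<integral>\<^sup>+y. ennreal (exp (- y\<^sup>2 / 8)) \<partial>lborel) < \<infinity>"
    by (simp add: integrable_iff_bounded)
  have "(\<integral>\<^sup>+x. ennreal (exp (- (x \<bullet> x) / 8)) \<partial>(lborel :: 'a measure))
      = (\<integral>\<^sup>+x. (\<Prod>b\<in>Basis. ennreal (exp (- (x \<bullet> b)\<^sup>2 / 8))) \<partial>(lborel :: 'a measure))"
    by (simp only: eq) (simp add: prod_ennreal)
  also have "\<dots> = (\<Prod>b\<in>(Basis::'a set). (\<integral>\<^sup>+y. ennreal (exp (- y\<^sup>2 / 8)) \<partial>lborel))"
    by (rule nn_integral_lborel_prod) auto
  also have "\<dots> < \<infinity>" using fin by (simp add: power_less_top_ennreal)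
  finally show ?thesis
    by (intro integrableI_bounded) auto
qed

text \<open>Half of the exponent pays for the polynomial: \<open>1 + r \<le> 3 + r^2/8\<close>
  bounds \<open>(1 + r)^N\<close> by \<open>N! e^3 exp (r^2/8)\<close>. The exponent
  \<open>1/4\<close>, half that of the density, is the one that survives when a translated density
  is dominated uniformly.\<close>

lemma integrable_power_exp:
  "integrable lborel (\<lambda>x::'a::euclidean_space. (1 + norm x) ^ N * exp (- (x \<bullet> x) / 4))"
proof (rule Bochner_Integration.integrable_bound)
  show "integrable lborel (\<lambda>x::'a. (fact N * exp 3) * exp (- (x \<bullet> x) / 8))"
    by (intro integrable_mult_right integrable_exp_square)
  show "AE x::'a in lborel. norm ((1 + norm x) ^ N * exp (- (x \<bullet> x) / 4))
      \<le> norm ((fact N * exp 3) * exp (- (x \<bullet> x) / 8))"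
  proof (rule AE_I2)
    fix x :: 'a
    define r where "r = norm x"
    have r: "0 \<le> r" "x \<bullet> x = r\<^sup>2" by (simp_all add: r_def power2_norm_eq_inner)
    have "1 + r \<le> 3 + r\<^sup>2 / 8"
      using zero_le_power2[of "r - 4"] by (simp add: power2_eq_square algebra_simps)
    then have "(1 + r) ^ N \<le> fact N * exp (3 + r\<^sup>2 / 8)"
      using power_le_fact_exp[of "1 + r" N] r(1)
      by (smt (verit, best) exp_le_cancel_iff fact_gt_zero mult_left_mono)
    then have "(1 + r) ^ N * exp (- r\<^sup>2 / 4) \<le> fact N * exp (3 + r\<^sup>2 / 8) * exp (- r\<^sup>2 / 4)"
      by (rule mult_right_mono) simp
    also have "\<dots> = fact N * exp 3 * exp (- r\<^sup>2 / 8)"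
      by (simp add: exp_add[symmetric] mult.assoc)
    finally show "norm ((1 + norm x) ^ N * exp (- (x \<bullet> x) / 4))
      \<le> norm ((fact N * exp 3) * exp (- (x \<bullet> x) / 8))"
      using r by (simp add: r_def[symmetric] abs_mult)
  qed
qed simp

lemma integrable_poly_growth_lborel:
  assumes "poly_growth p"
  shows "integrable lborel (\<lambda>x::'a::euclidean_space. p x * gauss_density x :: real)"
proof -
  obtain C N where C: "C \<ge> (0::real)" "\<And>x. norm (p x) \<le> C * (1 + norm x) ^ N" using poly_growthE[OF assms] by blast
  define k where "k = (1 / sqrt (2 * pi)) ^ DIM('a)"
  have k: "k \<ge> 0" by (simp add: k_def)
  have gd: "gauss_density x = k * exp (- (x \<bullet> x) / 2)" for x :: 'a
    by (simp only: gauss_density_eq k_def)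
  show ?thesis
  proof (rule Bochner_Integration.integrable_bound)
    show "integrable lborel (\<lambda>x::'a. (C * k) * ((1 + norm x) ^ N * exp (- (x \<bullet> x) / 4)))"
      by (intro integrable_mult_right integrable_power_exp)
    show "AE x in lborel. norm (p x * gauss_density x) \<le> norm ((C * k) * ((1 + norm x) ^ N * exp (- (x \<bullet> x) / 4)))"
    proof (rule AE_I2)
      fix x
      have "\<bar>p x\<bar> * (k * exp (- (x \<bullet> x) / 2)) \<le> (C * (1 + norm x) ^ N) * (k * exp (- (x \<bullet> x) / 4))"
        using C k by (intro mult_mono) auto
      then show "norm (p x * gauss_density x) \<le> norm ((C * k) * ((1 + norm x) ^ N * exp (- (x \<bullet> x) / 4)))"
        using C k by (simp add: gd abs_mult mult_ac)
    qed
    show "(\<lambda>x. p x * gauss_density x) \<in> borel_measurable lborel"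
      using poly_growth_borel[OF assms] by measurable
  qed
qed

lemma integral_gauss:
  fixes p :: "'a::euclidean_space \<Rightarrow> real"
  assumes "poly_growth p"
  shows "integrable gauss p" "integral\<^sup>L gauss p = (\<integral>x. p x * gauss_density x \<partial>lborel)"
proof -
  have [measurable]: "p \<in> borel_measurable borel" by (rule poly_growth_borel[OF assms])
  show "integral\<^sup>L gauss p = (\<integral>x. p x * gauss_density x \<partial>lborel)"
    unfolding gauss_def by (subst integral_density) (auto simp: gauss_density_nonneg mult.commute)
  show "integrable gauss p"
    unfolding gauss_def using integrable_poly_growth_lborel[OF assms]
    by (subst integrable_density) (auto simp: gauss_density_nonneg mult.commute)
qed

lemmas integrable_gauss = integral_gauss(1)

text \<open>The integral of a difference quotient of \<open>h * gauss_density\<close> vanishes by translation invariance of Lebesgue measure.\<close>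
lemma gauss_stein:
  fixes h h' :: "'a::euclidean_space \<Rightarrow> real"
  assumes der: "\<And>x. ((\<lambda>t. h (x + t *\<^sub>R v)) has_real_derivative h' x) (at 0)"
    and h: "poly_growth h" and h': "poly_growth h'"
  shows "(\<integral>x. h x * (x \<bullet> v) \<partial>gauss) = (\<integral>x. h' x \<partial>gauss)"
proof -
  define p where "p x = h' x - h x * (x \<bullet> v)" for x
  have p: "poly_growth p" unfolding p_def by (intro pg_intros h h')
  define \<psi> where "\<psi> x = h x * gauss_density x" for x
  define \<psi>' where "\<psi>' x = p x * gauss_density x" for x
  have int\<psi>: "integrable lborel \<psi>" unfolding \<psi>_def by (rule integrable_poly_growth_lborel[OF h])
  have [measurable]: "\<psi> \<in> borel_measurable borel" "\<psi>' \<in> borel_measurable borel"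
    unfolding \<psi>_def \<psi>'_def using poly_growth_borel[OF h] poly_growth_borel[OF p] by measurable
  define k where "k = (1 / sqrt (2 * pi)) ^ DIM('a)"
  have k: "k \<ge> 0" by (simp add: k_def)
  have gd: "gauss_density x = k * exp (- (x \<bullet> x) / 2)" for x :: 'a
    by (simp only: gauss_density_eq k_def)
  have der0: "((\<lambda>t. \<psi> (x + t *\<^sub>R v)) has_real_derivative \<psi>' x) (at 0)" for x
  proof -
    have eq: "(x + t *\<^sub>R v) \<bullet> (x + t *\<^sub>R v) = x \<bullet> x + 2 * t * (x \<bullet> v) + t\<^sup>2 * (v \<bullet> v)" for t
      by (simp add: inner_add_left inner_add_right inner_commute power2_eq_square algebra_simps)
    have "((\<lambda>t. exp (- ((x + t *\<^sub>R v) \<bullet> (x + t *\<^sub>R v)) / 2)) has_real_derivative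
        - (x \<bullet> v) * exp (- (x \<bullet> x) / 2)) (at 0)"
      unfolding eq by (auto intro!: derivative_eq_intros)
    from DERIV_mult[OF der[of x] DERIV_cmult[OF this, of k]] show ?thesis
      unfolding \<psi>_def \<psi>'_def gd p_def by (simp add: algebra_simps)
  qed
  have der1: "((\<lambda>t. \<psi> (x + t *\<^sub>R v)) has_real_derivative \<psi>' (x + s *\<^sub>R v)) (at s)" for x s
    using DERIV_shift[of "\<lambda>t. \<psi> (x + t *\<^sub>R v)" "\<psi>' (x + s *\<^sub>R v)" 0 s] der0[of "x + s *\<^sub>R v"]
    by (simp add: algebra_simps)
  obtain C N where C: "C \<ge> (0::real)" "\<And>x. norm (p x) \<le> C * (1 + norm x) ^ N" using poly_growthE[OF p] by blast
  \<comment> \<open>Constants for a domination uniform in the shift: \<open>(1 + |v|)^N\<close>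
    absorbs the translated polynomial and \<open>exp (|v|^2/2)\<close> the translated Gaussian, at
    the price of halving the exponent.\<close>
  define D where "D = C * (1 + norm v) ^ N * k * exp ((v \<bullet> v) / 2)"
  define w where "w x = D * ((1 + norm x) ^ N * exp (- (x \<bullet> x) / 4))" for x :: 'a
  have bound: "\<bar>\<psi>' (x + s *\<^sub>R v)\<bar> \<le> w x" if s: "\<bar>s\<bar> \<le> 1" for x s
  proof -
    define y where "y = x + s *\<^sub>R v"
    have sv: "norm (s *\<^sub>R v) \<le> norm v" using s by (simp add: mult_left_le_one_le)
    have ny: "norm y \<le> norm x + norm v"
      unfolding y_def using norm_triangle_ineq[of x "s *\<^sub>R v"] sv by linarith
    have "1 + norm y \<le> (1 + norm v) * (1 + norm x)"
      using ny mult_nonneg_nonneg[OF norm_ge_zero[of v] norm_ge_zero[of x]]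
      unfolding distrib_left distrib_right by linarith
    then have 1: "(1 + norm y) ^ N \<le> (1 + norm v) ^ N * (1 + norm x) ^ N"
      unfolding power_mult_distrib[symmetric] by (intro power_mono) auto
    have "x = y - s *\<^sub>R v" by (simp add: y_def)
    then have "norm x \<le> norm y + norm v" using norm_triangle_ineq4[of y "s *\<^sub>R v"] sv by simp
    then have "(norm x)\<^sup>2 \<le> (norm y + norm v)\<^sup>2" by (intro power_mono) auto
    also have "\<dots> \<le> 2 * (norm y)\<^sup>2 + 2 * (norm v)\<^sup>2"
      using zero_le_power2[of "norm y - norm v"] by (simp add: power2_eq_square algebra_simps)
    finally have "- (y \<bullet> y) / 2 \<le> (v \<bullet> v) / 2 + - (x \<bullet> x) / 4"
      by (simp add: power2_norm_eq_inner)
    then have "exp (- (y \<bullet> y) / 2) \<le> exp ((v \<bullet> v) / 2 + - (x \<bullet> x) / 4)" by simp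
    then have 2: "exp (- (y \<bullet> y) / 2) \<le> exp ((v \<bullet> v) / 2) * exp (- (x \<bullet> x) / 4)"
      by (simp only: exp_add)
    have "\<bar>\<psi>' y\<bar> = norm (p y) * (k * exp (- (y \<bullet> y) / 2))"
      using k by (simp add: \<psi>'_def gd abs_mult)
    also have "\<dots> \<le> (C * (1 + norm y) ^ N) * (k * exp (- (y \<bullet> y) / 2))"
      using C k by (intro mult_right_mono) auto
    also have "\<dots> \<le> (C * ((1 + norm v) ^ N * (1 + norm x) ^ N)) * (k * (exp ((v \<bullet> v) / 2) * exp (- (x \<bullet> x) / 4)))"
      using C(1) k 1 2 by (intro mult_mono mult_left_mono) auto
    also have "\<dots> = w x" by (simp add: w_def D_def mult_ac)
    finally show ?thesis by (simp add: y_def)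
  qed
  have intw: "integrable lborel w" unfolding w_def by (intro integrable_mult_right integrable_power_exp)
  define e where "e n = inverse (real (Suc n))" for n
  have e: "e n > 0" "e n \<le> 1" for n by (auto simp: e_def field_simps)
  define Q where "Q n x = (\<psi> (x + e n *\<^sub>R v) - \<psi> x) / e n" for n x
  have shift: "integrable lborel (\<lambda>x. \<psi> (x + c))" "(\<integral>x. \<psi> (x + c) \<partial>lborel) = (\<integral>x. \<psi> x \<partial>lborel)" for c
  proof -
    have "integrable (distr lborel borel ((+) c)) \<psi>" unfolding lborel_distr_plus by (rule int\<psi>)
    then show "integrable lborel (\<lambda>x. \<psi> (x + c))"
      by (subst (asm) integrable_distr_eq) (auto simp: add.commute)
    have "(\<integral>x. \<psi> x \<partial>lborel) = (\<integral>x. \<psi> x \<partial>(distr lborel borel ((+) c)))" unfolding lborel_distr_plus ..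
    also have "\<dots> = (\<integral>x. \<psi> (x + c) \<partial>lborel)"
      by (subst integral_distr) (auto simp: add.commute)
    finally show "(\<integral>x. \<psi> (x + c) \<partial>lborel) = (\<integral>x. \<psi> x \<partial>lborel)" ..
  qed
  have Q0: "(\<integral>x. Q n x \<partial>lborel) = 0" for n
    unfolding Q_def using shift int\<psi> by simp
  have Qb: "norm (Q n x) \<le> w x" for n x
  proof -
    \<comment> \<open>By the mean value theorem the difference quotient is a derivative at an
      intermediate point, to which the uniform domination applies.\<close>
    obtain z where z: "0 < z" "z < e n" "\<psi> (x + e n *\<^sub>R v) - \<psi> (x + 0 *\<^sub>R v) = (e n - 0) * \<psi>' (x + z *\<^sub>R v)"
      using MVT2[OF e(1)[of n], of "\<lambda>t. \<psi> (x + t *\<^sub>R v)" "\<lambda>s. \<psi>' (x + s *\<^sub>R v)"] der1 by auto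
    then have "Q n x = \<psi>' (x + z *\<^sub>R v)" using e(1)[of n] by (simp add: Q_def)
    then show ?thesis using bound[of z x] z e(2)[of n] by simp
  qed
  have Ql: "(\<lambda>n. Q n x) \<longlonglongrightarrow> \<psi>' x" for x
  proof -
    have "(\<lambda>t. (\<psi> (x + t *\<^sub>R v) - \<psi> x) / t) \<midarrow>0\<rightarrow> \<psi>' x"
      using der0[of x] by (simp add: DERIV_def)
    moreover have "filterlim e (at 0) sequentially"
      unfolding filterlim_at using e(1) LIMSEQ_inverse_real_of_nat by (auto simp: e_def[abs_def] less_imp_neq)
    ultimately show ?thesis unfolding Q_def by (rule filterlim_compose)
  qed
  have Qm: "Q n \<in> borel_measurable lborel" for n unfolding Q_def by measurable
  have "(\<lambda>n. \<integral>x. Q n x \<partial>lborel) \<longlonglongrightarrow> (\<integral>x. \<psi>' x \<partial>lborel)"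
    by (rule integral_dominated_convergence[where w=w]) (use Qm Ql Qb intw in auto)
  then have "(\<lambda>n. 0) \<longlonglongrightarrow> (\<integral>x. \<psi>' x \<partial>lborel)"
    by (simp only: Q0)
  then have "(\<integral>x. \<psi>' x \<partial>lborel) = 0"
    using LIMSEQ_unique tendsto_const by blast
  then have "integral\<^sup>L gauss p = 0"
    unfolding integral_gauss(2)[OF p] \<psi>'_def .
  moreover have "integral\<^sup>L gauss p = (\<integral>x. h' x \<partial>gauss) - (\<integral>x. h x * (x \<bullet> v) \<partial>gauss)"
    unfolding p_def
    by (rule Bochner_Integration.integral_diff) (auto intro!: integrable_gauss pg_intros h h')
  ultimately show ?thesis by linarith
qed

section \<open>Matrix units and divergences of matrix fields\<close>

lemma sum_matrix_Basis: "(\<Sum>b\<in>(Basis :: (real^'m^'n) set). f b) = (\<Sum>i\<in>UNIV. \<Sum>j\<in>UNIV. f (axis i (axis j 1)))"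
proof -
  have inj: "inj_on (\<lambda>(i,j). axis i (axis j 1) :: real^'m^'n) UNIV"
    by (auto simp: inj_on_def axis_eq_axis)
  have "Basis = (\<lambda>(i,j). axis i (axis j 1) :: real^'m^'n) ` UNIV"
    by (auto simp: Basis_vec_def)
  then have "(\<Sum>b\<in>(Basis :: (real^'m^'n) set). f b) = (\<Sum>(i,j)\<in>UNIV. f (axis i (axis j 1)))"
    using sum.reindex[OF inj, of f] by (simp add: o_def case_prod_unfold)
  then show ?thesis by (simp add: UNIV_Times_UNIV[symmetric] sum.cartesian_product del: UNIV_Times_UNIV)
qed

lemma std_gauss_mat_eq: "std_gauss_mat = (gauss :: (real^'m^'n) measure)"
proof -
  have "gauss_density G = (\<Prod>i\<in>UNIV. \<Prod>j\<in>UNIV. std_normal_density (G $ i $ j))" for G :: "real^'m^'n"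
  proof -
    have inj: "inj_on (\<lambda>(i,j). axis i (axis j 1) :: real^'m^'n) UNIV"
      by (auto simp: inj_on_def axis_eq_axis)
    have "Basis = (\<lambda>(i,j). axis i (axis j 1) :: real^'m^'n) ` UNIV"
      by (auto simp: Basis_vec_def)
    then have "gauss_density G = (\<Prod>(i,j)\<in>UNIV. std_normal_density (G \<bullet> axis i (axis j 1)))"
      unfolding gauss_density_def 
      using prod.reindex[OF inj, of "\<lambda>b. std_normal_density (G \<bullet> b)"] by (simp add: o_def case_prod_unfold)
    then show ?thesis by (simp add: UNIV_Times_UNIV[symmetric] prod.cartesian_product inner_axis del: UNIV_Times_UNIV)
  qed
  then show ?thesis by (simp add: std_gauss_mat_def gauss_def)
qed

lemma mult_axis_mult:
  fixes X :: "real^'n^'r" and Y :: "real^'c^'m"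
  shows "(X ** axis i (axis j 1) ** Y) $ a $ l = X $ a $ i * Y $ j $ l"
proof -
  have 1: "(X ** axis i (axis j 1)) $ a $ k = (if k = j then X $ a $ i else 0)" for k :: 'm
  proof -
    have "(X ** axis i (axis j 1)) $ a $ k = (\<Sum>m\<in>UNIV. if m = i then X $ a $ m * (axis j 1 :: real^'m) $ k else 0)"
      unfolding matrix_matrix_mult_def by (simp add: axis_def[of i] if_distrib if_distribR cong: if_cong)
    then show ?thesis by (simp add: axis_def)
  qed
  have "(X ** axis i (axis j 1) ** Y) $ a $ l = (\<Sum>k\<in>UNIV. (X ** axis i (axis j 1)) $ a $ k * Y $ k $ l)"
    by (simp add: matrix_matrix_mult_def[of _ Y])
  also have "\<dots> = (\<Sum>k\<in>UNIV. (if k = j then X $ a $ i * Y $ k $ l else 0))"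
    by (intro sum.cong) (auto simp: 1)
  finally have "(X ** axis i (axis j 1) ** Y) $ a $ l = (\<Sum>k\<in>UNIV. (if k = j then X $ a $ i * Y $ k $ l else 0))" .
  then show ?thesis by simp
qed

text \<open>This contraction and its transposed companion evaluate every divergence below: a
  derivative in direction \<open>b\<close> is a sum of terms \<open>X b Y\<close> and
  \<open>X b^T Y\<close>.\<close>

lemma sum_Basis_mult_mult: 
  "(\<Sum>b\<in>(Basis :: (real^'m^'n) set). b \<bullet> (X ** b ** Y)) = trace X * trace Y"
proof -
  have "axis i (axis j 1) \<bullet> (X ** axis i (axis j 1) ** Y) = X $ i $ i * Y $ j $ j" for i :: 'n and j :: 'm
    by (simp add: inner_axis' mult_axis_mult)
  then show ?thesis by (simp add: sum_matrix_Basis trace_def sum_product)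
qed

lemma sum_Basis_mult_transpose_mult:
  "(\<Sum>b\<in>(Basis :: (real^'m^'n) set). b \<bullet> (X ** transpose b ** Y)) = X \<bullet> Y"
proof -
  have "axis i (axis j 1) \<bullet> (X ** transpose (axis i (axis j 1)) ** Y) = X $ i $ j * Y $ i $ j" for i :: 'n and j :: 'm
  proof -
    have "transpose (axis i (axis j (1::real))) $ k $ l = axis j (axis i 1) $ k $ l" for k l
      by (simp add: transpose_def axis_def)
    then have "transpose (axis i (axis j (1::real))) = axis j (axis i 1)"
      by (simp only: vec_eq_iff) blast
    then show ?thesis by (simp only: inner_axis' mult_axis_mult) simp
  qed
  then show ?thesis by (simp add: sum_matrix_Basis inner_mat_def)
qed

text \<open>\<open>C\<close> selects the directions of differentiation, since
  \<open>(C G) . b = G . (C^T b)\<close>. Taking \<open>C = P\<close> moves the Wishart part; a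
  \<open>C\<close> with \<open>C P = 0\<close> moves \<open>G\<close> while \<open>P G\<close> stays
  fixed.\<close>

lemma gauss_stein_matrix:
  fixes C :: "real^'n^'n" and F :: "real^'m^'n \<Rightarrow> real^'m^'n"
  assumes der: "\<And>G b. b \<in> Basis \<Longrightarrow> ((\<lambda>t. F (G + t *\<^sub>R (transpose C ** b))) has_vector_derivative F' G b) (at 0)"
    and F: "poly_growth F" and F': "\<And>b. b \<in> Basis \<Longrightarrow> poly_growth (\<lambda>G. F' G b)"
  shows "(\<integral>G. (C ** G) \<bullet> F G \<partial>gauss) = (\<integral>G. (\<Sum>b\<in>Basis. b \<bullet> F' G b) \<partial>gauss)"
proof -
  have "(C ** G) \<bullet> F G = (\<Sum>b\<in>Basis. (b \<bullet> F G) * (G \<bullet> (transpose C ** b)))" for G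
  proof -
    have "(C ** G) \<bullet> b = G \<bullet> (transpose C ** b)" for b
      by (rule inner_mult_left)
    then show ?thesis by (subst euclidean_inner) (simp add: inner_commute[of "F G"] mult.commute)
  qed
  then have "(\<integral>G. (C ** G) \<bullet> F G \<partial>gauss) = (\<Sum>b\<in>Basis. \<integral>G. (b \<bullet> F G) * (G \<bullet> (transpose C ** b)) \<partial>gauss)"
    by (simp only:) (intro Bochner_Integration.integral_sum integrable_gauss pg_intros F)
  also have "\<dots> = (\<Sum>b\<in>Basis. \<integral>G. b \<bullet> F' G b \<partial>gauss)"
  proof (rule sum.cong[OF refl], rule gauss_stein)
    fix b :: "real^'m^'n" and G assume b: "b \<in> Basis"
    show "((\<lambda>t. b \<bullet> F (G + t *\<^sub>R (transpose C ** b))) has_real_derivative b \<bullet> F' G b) (at 0)"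
      unfolding has_real_derivative_iff_has_vector_derivative
      by (rule bounded_linear.has_vector_derivative[OF bounded_linear_inner_right der[OF b]])
  qed (auto intro!: pg_intros F F')
  also have "\<dots> = (\<integral>G. (\<Sum>b\<in>Basis. b \<bullet> F' G b) \<partial>gauss)"
    by (intro Bochner_Integration.integral_sum[symmetric] integrable_gauss pg_intros F')
  finally show ?thesis .
qed

subsection \<open>Regularised inverse Wishart matrices\<close>

text \<open>Caratheodory's form of differentiability. It suits the ridge inverse, whose difference
  quotient is given exactly by the resolvent identity.\<close>

lemma has_vector_derivative_caratheodory:
  fixes f :: "real \<Rightarrow> 'a::real_normed_vector"
  assumes "\<And>t. f t = f 0 + t *\<^sub>R g t" "(g \<longlongrightarrow> g 0) (at 0)"
  shows "(f has_vector_derivative g 0) (at 0)"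
  unfolding has_vector_derivative_def has_derivative_at
proof
  show "bounded_linear (\<lambda>x. x *\<^sub>R g 0)" by (rule bounded_linear_scaleR_left)
  have eq: "norm (f h - f 0 - h *\<^sub>R g 0) / \<bar>h\<bar> = norm (g h - g 0)" if "h \<noteq> 0" for h
  proof -
    have "f h - f 0 - h *\<^sub>R g 0 = h *\<^sub>R (g h - g 0)"
      by (subst assms(1)) (simp add: scaleR_diff_right)
    then show ?thesis using that by simp
  qed
  have "((\<lambda>h. norm (g h - g 0)) \<longlongrightarrow> 0) (at 0)"
    using assms(2) by (simp add: tendsto_norm_zero_iff LIM_zero_iff)
  then show "(\<lambda>h. norm (f (0 + h) - f 0 - h *\<^sub>R g 0) / norm h) \<midarrow>0\<rightarrow> 0"
    by (rule Lim_transform_eventually) (simp add: eventually_at_filter eq always_eventually)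
qed

lemmas has_vector_derivative_matmul = bounded_bilinear.has_vector_derivative[OF bounded_bilinear_matrix_mult]
  and has_vector_derivative_transpose = bounded_linear.has_vector_derivative[OF bounded_linear_transpose]

lemma has_vector_derivative_line: "((\<lambda>t. G + t *\<^sub>R V) has_vector_derivative V) (at 0)"
  by (auto intro!: derivative_eq_intros)

text \<open>\<open>P\<close> acts on the full space, so no index type of size \<open>k\<close> is
  needed; the dimension enters only as \<open>trace P\<close>.\<close>

locale ridge =
  fixes P :: "real^'n^'n" and e :: real
  assumes P_sym: "transpose P = P" and P_idem: "P ** P = P" and e_pos: "0 < e"
begin

definition W :: "real^'m^'n \<Rightarrow> real^'n^'n" where
  "W G = P ** G ** transpose (P ** G)"

definition R :: "real^'m^'n \<Rightarrow> real^'n^'n" where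
  "R G = matrix_inv (W G + e *\<^sub>R mat 1)"

text \<open>The transpose of \<open>q G\<close> is the ridge-regularised pseudoinverse of
  \<open>P G\<close>: multiplying \<open>P G\<close> by it on the right gives
  \<open>I - e R\<close>.\<close>

definition q :: "real^'m^'n \<Rightarrow> real^'m^'n" where
  "q G = R G ** P ** G"

text \<open>On the kernel of \<open>P\<close> the matrix \<open>R\<close> is \<open>1/e\<close>
  times the identity; the factor \<open>P\<close> discards this part. What remains are the traces of
  the first three powers of the regularised inverse Wishart matrix.\<close>

definition t1 :: "real^'m^'n \<Rightarrow> real" where "t1 G = trace (R G ** P)"
definition t2 :: "real^'m^'n \<Rightarrow> real" where "t2 G = trace (R G ** R G ** P)"
definition t3 :: "real^'m^'n \<Rightarrow> real" where "t3 G = trace (R G ** R G ** R G ** P)"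

lemma psd_W: "psd (W G)"
  unfolding W_def by (rule psd_gram')

lemma R_inverse: "R G ** (W G + e *\<^sub>R mat 1) = mat 1" "(W G + e *\<^sub>R mat 1) ** R G = mat 1"
proof -
  have "x = 0" if "(W G + e *\<^sub>R mat 1) *v x = 0" for x
  proof -
    have "0 = x \<bullet> ((W G + e *\<^sub>R mat 1) *v x)" using that by simp
    also have "\<dots> = x \<bullet> (W G *v x) + e * (x \<bullet> x)"
      by (simp add: matrix_vector_mult_add_rdistrib scaleR_matrix_vector_assoc[symmetric] inner_add_right)
    finally have "e * (x \<bullet> x) \<le> 0" using psd_ge0[OF psd_W, of x G] by linarith
    then have "x \<bullet> x \<le> 0" using e_pos by (simp add: mult_le_0_iff)
    then show ?thesis by (metis inner_eq_zero_iff inner_ge_zero order_antisym)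
  qed
  then have "invertible (W G + e *\<^sub>R mat 1)"
    using invertible_left_inverse matrix_left_invertible_ker by blast
  then have "(W G + e *\<^sub>R mat 1) ** R G = mat 1 \<and> R G ** (W G + e *\<^sub>R mat 1) = mat 1"
    unfolding R_def matrix_inv_def invertible_def by (rule someI_ex)
  then show "R G ** (W G + e *\<^sub>R mat 1) = mat 1" "(W G + e *\<^sub>R mat 1) ** R G = mat 1" by auto
qed

lemma RW: "R G ** W G = mat 1 - e *\<^sub>R R G" and WR: "W G ** R G = mat 1 - e *\<^sub>R R G"
  using R_inverse[of G] by (simp_all add: mat_simps eq_diff_eq)

lemma R_sym: "transpose (R G) = R G"
proof -
  have "transpose (R G) ** (W G + e *\<^sub>R mat 1) = mat 1"
    using arg_cong[OF R_inverse(2)[of G], of transpose]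
    by (simp add: mat_simps psd_sym[OF psd_W])
  then have "transpose (R G) ** ((W G + e *\<^sub>R mat 1) ** R G) = R G"
    by (simp only: matrix_mul_assoc matrix_mul_lid)
  then show ?thesis by (simp add: R_inverse)
qed

lemma PW: "P ** W G = W G" and WP: "W G ** P = W G"
proof -
  show "P ** W G = W G" by (simp add: W_def matrix_mul_assoc P_idem)
  then have "transpose (P ** W G) = transpose (W G)" by simp
  then show "W G ** P = W G" by (simp add: mat_simps P_sym psd_sym[OF psd_W])
qed

lemma PR: "P ** R G = R G ** P"
proof -
  have "R G ** ((W G + e *\<^sub>R mat 1) ** P) ** R G = R G ** (P ** (W G + e *\<^sub>R mat 1)) ** R G"
    by (simp only: mat_simps PW WP matrix_mul_lid matrix_mul_rid)
  then have "R G ** (W G + e *\<^sub>R mat 1) ** P ** R G = R G ** P ** ((W G + e *\<^sub>R mat 1) ** R G)"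
    by (simp only: matrix_mul_assoc)
  then show ?thesis by (simp only: R_inverse matrix_mul_lid matrix_mul_rid)
qed

lemma PR': "X ** P ** R G = X ** R G ** P"
  by (metis PR matrix_mul_assoc)

lemma PP': "X ** P ** P = X ** P"
  by (metis P_idem matrix_mul_assoc)

lemma psd_R: "psd (R G)"
proof (rule psdI)
  fix x
  define y where "y = R G *v x"
  have "(W G + e *\<^sub>R mat 1) *v y = x"
    by (simp add: y_def matrix_vector_mul_assoc R_inverse)
  then have "x \<bullet> (R G *v x) = y \<bullet> ((W G + e *\<^sub>R mat 1) *v y)"
    by (simp add: y_def inner_commute)
  moreover have "psd (W G + e *\<^sub>R mat 1)"
    using e_pos by (intro psd_add psd_W psd_scaleR psd_mat1) simp
  ultimately show "0 \<le> x \<bullet> (R G *v x)" using psd_ge0 by metis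
qed (rule R_sym)

text \<open>Pairing \<open>R W = I - e R\<close> with \<open>R\<close> gives a nonnegative number,
  whence \<open>e |R|^2 \<le> I . R\<close>. The bound is uniform in \<open>G\<close>, which puts
  \<open>R\<close> into the class of polynomial growth.\<close>

lemma norm_R: "norm (R G) \<le> norm (mat 1 :: real^'n^'n) / e"
proof -
  have "(R G ** W G) \<bullet> R G = W G \<bullet> (R G ** R G)"
    by (simp add: inner_mult_left R_sym)
  moreover have "psd (R G ** R G)" using psd_gram[of "R G"] by (simp add: R_sym)
  ultimately have "0 \<le> (R G ** W G) \<bullet> R G" using psd_inner_nonneg psd_W by metis
  then have "e * (norm (R G))\<^sup>2 \<le> mat 1 \<bullet> R G"
    by (simp add: RW inner_diff_left power2_norm_eq_inner)
  also have "\<dots> \<le> norm (mat 1 :: real^'n^'n) * norm (R G)" by (rule norm_cauchy_schwarz)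
  finally have "e * norm (R G) * norm (R G) \<le> norm (mat 1 :: real^'n^'n) * norm (R G)"
    by (simp add: power2_eq_square mult.assoc)
  then have "norm (R G) = 0 \<or> e * norm (R G) \<le> norm (mat 1 :: real^'n^'n)"
    using mult_right_le_imp_le norm_ge_zero order_le_less by metis
  then show ?thesis using e_pos by (auto simp: field_simps)
qed

lemma resolvent: "R G - R H = R G ** (W H - W G) ** R H"
proof -
  have "R G ** (W H - W G) ** R H = R G ** (W H ** R H) - (R G ** W G) ** R H"
    by (simp add: mat_simps matrix_mul_assoc)
  then show ?thesis unfolding RW WR by (simp add: mat_simps)
qed

lemma poly_growth_W: "poly_growth W"
  unfolding W_def by (intro pg_intros)

lemma continuous_R:
  fixes G :: "real^'m^'n"
  shows "isCont R G"
proof -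
  define c where "c = norm (mat 1 :: real^'n^'n) / e"
  have "isCont W G" 
    by (rule continuous_on_interior[OF poly_growth_cont[OF poly_growth_W]]) simp
  then have "((\<lambda>H. c * norm (W G - W H) * c) \<longlongrightarrow> c * norm (W G - W G) * c) (at G)"
    by (intro tendsto_intros) (simp add: isCont_def)
  then have lim: "((\<lambda>H. c * norm (W G - W H) * c) \<longlongrightarrow> 0) (at G)" by simp
  have "norm (R H - R G) \<le> c * norm (W G - W H) * c" for H :: "real^'m^'n"
  proof -
    have "norm (R H - R G) \<le> norm (R H ** (W G - W H)) * norm (R G)"
      unfolding resolvent by (rule norm_mult_le)
    also have "\<dots> \<le> norm (R H) * norm (W G - W H) * norm (R G)"
      by (intro mult_right_mono norm_mult_le) simp
    also have "\<dots> \<le> c * norm (W G - W H) * c"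
      unfolding c_def using e_pos by (intro mult_mono norm_R mult_right_mono) auto
    finally show ?thesis .
  qed
  then have "((\<lambda>H. R H - R G) \<longlongrightarrow> 0) (at G)"
    by (intro Lim_null_comparison[OF _ lim] always_eventually) simp
  then show ?thesis by (simp add: isCont_def LIM_zero_iff)
qed

lemma poly_growth_R [pg_intros]: "poly_growth R"
proof (rule poly_growthI[where N=0])
  show "continuous_on UNIV R" by (simp add: continuous_on_eq_continuous_at continuous_R)
  show "norm (R G) \<le> (norm (mat 1 :: real^'n^'n) / e) * (1 + norm G) ^ 0" for G :: "real^'m^'n"
    by (simp add: norm_R)
qed

lemma poly_growth_q [pg_intros]: "poly_growth q"
  and poly_growth_t1 [pg_intros]: "poly_growth t1"
  and poly_growth_t2 [pg_intros]: "poly_growth t2"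
  and poly_growth_t3 [pg_intros]: "poly_growth t3"
  unfolding q_def[abs_def] t1_def[abs_def] t2_def[abs_def] t3_def[abs_def] by (intro pg_intros)+

text \<open>Here \<open>q q^T = R W R\<close> and \<open>R W = I - e R\<close>. The later
  contractions of \<open>q\<close> follow the same pattern: a trace of one power of
  \<open>R\<close>, minus \<open>e\<close> times that of the next.\<close>

lemma qq: "q G ** transpose (q G) = R G ** P - e *\<^sub>R (R G ** R G ** P)"
proof -
  have "q G ** transpose (q G) = R G ** W G ** R G"
    by (simp add: q_def W_def mat_simps P_sym R_sym matrix_mul_assoc)
  also have "\<dots> = R G ** (W G ** P) ** R G" by (simp only: WP)
  also have "\<dots> = (R G ** W G) ** P ** R G" by (simp only: matrix_mul_assoc)
  also have "\<dots> = R G ** P - e *\<^sub>R (R G ** R G ** P)" unfolding RW by (simp add: mat_simps PR PR')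
  finally show ?thesis .
qed

lemma Pq: "P ** q G = q G"
  by (simp add: q_def PR PR' PP' matrix_mul_assoc)

lemma inner_gq: "(P ** G) \<bullet> q G = trace P - e * t1 G"
proof -
  have "(P ** G) \<bullet> q G = trace (R G ** W G ** P)"
  proof -
    have "(P ** G) \<bullet> q G = trace (transpose (P ** G) ** (R G ** P ** G))"
      by (simp only: trace_eq_inner q_def)
    also have "\<dots> = trace (R G ** P ** G ** transpose (P ** G))" by (rule trace_mul_sym)
    also have "R G ** P ** G ** transpose (P ** G) = R G ** (W G ** P)"
      by (simp only: WP) (simp only: W_def matrix_mul_assoc)
    finally show ?thesis by (simp only: matrix_mul_assoc)
  qed
  then show ?thesis by (simp add: RW mat_simps trace_sub t1_def trace_mat1_inner[of "_ *\<^sub>R _"] inner_scaleR_right flip: trace_mat1_inner)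
qed

lemma inner_qq: "q G \<bullet> q G = t1 G - e * t2 G"
proof -
  have "q G \<bullet> q G = trace (q G ** transpose (q G))"
    by (metis trace_eq_inner trace_mul_sym)
  then show ?thesis by (simp add: qq t1_def t2_def trace_mat1_inner inner_diff_right)
qed

lemma inner_qRq: "q G \<bullet> (R G ** q G) = t2 G - e * t3 G"
proof -
  have "q G \<bullet> (R G ** q G) = trace (transpose (q G) ** (R G ** q G))"
    by (simp only: trace_eq_inner)
  also have "\<dots> = trace (R G ** (q G ** transpose (q G)))"
    by (subst trace_mul_sym) (simp only: matrix_mul_assoc)
  finally show ?thesis by (simp add: qq t2_def t3_def trace_mat1_inner inner_diff_right mat_simps matrix_mul_assoc)
qed

lemma psd_RP: "psd (R G ** P)"
  using psd_conj[OF psd_R[of G], of P] by (simp add: P_sym PR PP' P_idem)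

lemma psd_RRP: "psd (R G ** R G ** P)"
proof -
  have "R G ** R G ** P = transpose (R G ** P) ** (R G ** P)"
    by (simp add: mat_simps P_sym R_sym PR PR' PP' matrix_mul_assoc)
  then show ?thesis using psd_gram by metis
qed

lemma psd_RRRP: "psd (R G ** R G ** R G ** P)"
proof -
  have "R G ** R G ** R G ** P = transpose (R G) ** (R G ** P) ** R G"
    by (simp add: mat_simps P_sym R_sym PR PR' PP' matrix_mul_assoc)
  then show ?thesis using psd_conj[OF psd_RP] by metis
qed

lemma t_nonneg: "0 \<le> t1 G" "0 \<le> t2 G" "0 \<le> t3 G"
  unfolding t1_def t2_def t3_def by (intro psd_trace_nonneg psd_RP psd_RRP psd_RRRP)+

lemma t2_norm: "(norm (R G ** P))\<^sup>2 = t2 G"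
  unfolding power2_norm_eq_inner t2_def
  by (simp add: trace_eq_inner[symmetric] mat_simps P_sym R_sym PR PR' PP' matrix_mul_assoc)

lemma norm_qq: "(norm (q G ** transpose (q G)))\<^sup>2 \<le> t2 G"
proof -
  have "psd (R G ** P - q G ** transpose (q G))"
    using psd_scaleR[OF psd_RRP less_imp_le[OF e_pos]] by (simp add: qq)
  then have "norm (q G ** transpose (q G)) \<le> norm (R G ** P)"
    by (intro psd_norm_mono psd_gram')
  then show ?thesis unfolding t2_norm[symmetric] by (intro power_mono) auto
qed

end

lemma trace_scaleR: "trace (c *\<^sub>R A) = c * trace (A :: real^'n^'n)"
  unfolding trace_mat1_inner by simp

section \<open>Derivatives of the ridge inverse and the integration-by-parts identities\<close>

context ridge
begin

text \<open>This is \<open>- R (dW) R\<close> for \<open>dW = P b (P G)^T + P G (P b)^T\<close>,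
  shortened by \<open>(P G)^T R = q^T\<close>.\<close>

definition dR :: "real^'m^'n \<Rightarrow> real^'m^'n \<Rightarrow> real^'n^'n" where
  "dR G b = - (R G ** P ** b ** transpose (q G) + q G ** transpose b ** P ** R G)"

lemma R_derivative:
  fixes G b :: "real^'m^'n"
  shows "((\<lambda>t. R (G + t *\<^sub>R (transpose P ** b))) has_vector_derivative dR G b) (at 0)"
proof -
  define V where "V = P ** b"
  define A where "A = V ** transpose (P ** G) + (P ** G) ** transpose V"
  define S where "S t = R (G + t *\<^sub>R V)" for t
  have PV: "P ** V = V" by (simp add: V_def matrix_mul_assoc P_idem)
  have W: "W (G + t *\<^sub>R V) - W G = t *\<^sub>R (A + t *\<^sub>R (V ** transpose V))" for t
    unfolding W_def A_def
    by (simp add: matmul.add_right matmul.add_left matmul.scaleR_right matmul.scaleR_left transpose_add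
        transpose_scaleR PV scaleR_add_right)
  \<comment> \<open>The difference quotient of \<open>S\<close>, written through the resolvent
    identity without dividing by \<open>t\<close>; continuity of \<open>R\<close> alone then gives
    its limit.\<close>
  define D where "D t = - (S t ** (A + t *\<^sub>R (V ** transpose V)) ** R G)" for t
  have S0: "S 0 = R G" by (simp add: S_def)
  have "S t = S 0 + t *\<^sub>R D t" for t
  proof -
    have "S t - S 0 = - (S t ** (W (G + t *\<^sub>R V) - W G) ** R G)"
      unfolding S0 unfolding S_def resolvent[of "G + t *\<^sub>R V" G] by (simp add: mat_simps)
    then show ?thesis unfolding W D_def by (simp add: mat_simps algebra_simps)
  qed
  moreover have "(D \<longlongrightarrow> D 0) (at 0)"
  proof -
    have "isCont (\<lambda>t. G + t *\<^sub>R V) 0" by (intro continuous_intros)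
    then have "isCont S 0" unfolding S_def
      by (rule isCont_o2) (rule continuous_R)
    then have "isCont D 0" unfolding D_def
      by (intro continuous_intros bounded_bilinear.continuous[OF bounded_bilinear_matrix_mult])
    then show ?thesis by (simp add: isCont_def)
  qed
  ultimately have "(S has_vector_derivative D 0) (at 0)"
    by (rule has_vector_derivative_caratheodory)
  moreover have "D 0 = dR G b"
    unfolding D_def dR_def S0 A_def V_def q_def
    by (simp add: mat_simps matrix_mul_assoc P_sym R_sym PR PR' PP' P_idem)
  ultimately show ?thesis by (simp add: S_def[abs_def] V_def P_sym)
qed

lemma poly_growth_dR [pg_intros]: "poly_growth (\<lambda>G. dR G b)"
  unfolding dR_def by (intro pg_intros)

definition dq :: "real^'m^'n \<Rightarrow> real^'m^'n \<Rightarrow> real^'m^'n" where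
  "dq G b = dR G b ** P ** G + R G ** P ** b"

lemma poly_growth_dq [pg_intros]: "poly_growth (\<lambda>G. dq G b)"
  unfolding dq_def by (intro pg_intros)

lemma q_derivative: "((\<lambda>t. q (G + t *\<^sub>R (transpose P ** b))) has_vector_derivative dq G b) (at 0)"
proof -
  have "((\<lambda>t. R (G + t *\<^sub>R (transpose P ** b)) ** P ** (G + t *\<^sub>R (transpose P ** b)))
     has_vector_derivative (R (G + 0 *\<^sub>R (transpose P ** b)) ** P ** (transpose P ** b)
      + (R (G + 0 *\<^sub>R (transpose P ** b)) ** 0 + dR G b ** P) ** (G + 0 *\<^sub>R (transpose P ** b)))) (at 0)"
    by (intro has_vector_derivative_matmul R_derivative has_vector_derivative_line has_vector_derivative_const)
  then show ?thesis
    unfolding q_def[abs_def] dq_def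
    by (simp add: P_sym PP' matrix_mul_assoc matmul.zero_right add.commute)
qed

lemma t1_derivative:
  "((\<lambda>t. t1 (G + t *\<^sub>R (transpose P ** b))) has_vector_derivative - 2 * (b \<bullet> (R G ** q G))) (at 0)"
proof -
  have bl: "bounded_linear (\<lambda>X. trace (X ** P))"
    unfolding trace_mat1_inner
    by (intro bounded_linear_compose[OF bounded_linear_inner_right]
        bounded_bilinear.bounded_linear_left[OF bounded_bilinear_matrix_mult])
  have 1: "trace (R G ** P ** b ** transpose (q G) ** P) = b \<bullet> (R G ** q G)"
  proof -
    have "trace (R G ** P ** b ** transpose (q G) ** P) = trace ((R G ** P ** b) ** transpose (P ** q G))"
      by (simp add: mat_simps P_sym matrix_mul_assoc)
    also have "\<dots> = trace (transpose (q G) ** (R G ** P ** b))"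
      by (subst trace_mul_sym) (simp only: Pq)
    also have "\<dots> = q G \<bullet> ((R G ** P) ** b)" by (simp add: trace_eq_inner)
    also have "\<dots> = b \<bullet> (transpose (R G ** P) ** q G)" by (simp only: inner_commute[of "q G"] inner_mult_left)
    also have "transpose (R G ** P) ** q G = R G ** (P ** q G)"
      by (simp add: mat_simps P_sym R_sym PR matrix_mul_assoc)
    finally show ?thesis by (simp only: Pq)
  qed
  have "trace (q G ** transpose b ** P ** R G ** P) = trace (transpose (q G ** transpose b ** P ** R G ** P))"
    by (simp add: trace_def transpose_def)
  also have "transpose (q G ** transpose b ** P ** R G ** P) = P ** (R G ** P ** b ** transpose (q G))"
    by (simp add: mat_simps P_sym R_sym matrix_mul_assoc)
  also have "trace \<dots> = b \<bullet> (R G ** q G)"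
    unfolding 1[symmetric] by (rule trace_mul_sym)
  finally have "trace (dR G b ** P) = - 2 * (b \<bullet> (R G ** q G))"
    using 1 by (simp add: dR_def mat_simps trace_neg trace_add trace_sub)
  with bounded_linear.has_vector_derivative[OF bl R_derivative[of G b]]
  show ?thesis by (simp add: t1_def[abs_def])
qed

lemma qtq: "transpose (q G) ** (P ** G) = transpose (P ** G) ** q G"
  by (simp add: q_def mat_simps P_sym R_sym PR PR' PP' matrix_mul_assoc)

lemma trace_gq: "trace (transpose (q G) ** (P ** G)) = trace P - e * t1 G"
  by (simp add: qtq trace_eq_inner inner_gq)

text \<open>The first term comes from differentiating the explicit factor \<open>G\<close>, the
  other two from the two halves of \<open>dR\<close>.\<close>

lemma div_q:
  fixes G :: "real^'m^'n"
  shows "(\<Sum>b\<in>Basis. b \<bullet> dq G b) = real CARD('m) * t1 G - t1 G * (trace P - e * t1 G) - (t1 G - e * t2 G)"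
proof -
  have "dq G b = (R G ** P) ** b ** mat 1 - (R G ** P) ** b ** (transpose (q G) ** (P ** G)) - q G ** transpose b ** q G" for b
    by (simp add: dq_def dR_def mat_simps matrix_mul_assoc) (simp add: q_def matrix_mul_assoc PR PR' PP')
  then have "(\<Sum>b\<in>Basis. b \<bullet> dq G b) = trace (R G ** P) * trace (mat 1 :: real^'m^'m)
      - trace (R G ** P) * trace (transpose (q G) ** (P ** G)) - q G \<bullet> q G"
    by (simp only: inner_diff_right sum_subtractf sum_Basis_mult_mult sum_Basis_mult_transpose_mult)
  then show ?thesis by (simp add: trace_I trace_gq inner_qq t1_def[symmetric])
qed

text \<open>With \<open>k = trace P\<close> and \<open>p = CARD('m) - k\<close>, the identity
  becomes \<open>k = (p - 1) E t1\<close> for \<open>e = 0\<close>.\<close>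

lemma stein_1:
  "(\<integral>G. trace P - e * t1 G \<partial>(gauss :: (real^'m^'n) measure))
    = (\<integral>G. real CARD('m) * t1 G - t1 G * (trace P - e * t1 G) - (t1 G - e * t2 G) \<partial>(gauss :: (real^'m^'n) measure))"
  using gauss_stein_matrix[where C=P and F="q :: real^'m^'n \<Rightarrow> _" and F'=dq, OF q_derivative poly_growth_q poly_growth_dq]
  by (simp add: inner_gq div_q)

text \<open>The vector field is \<open>R q\<close>. For \<open>e = 0\<close> the identity becomes
  \<open>(p - 2) E t2 = E t1 + E (t1^2)\<close>, which involves a new second moment.\<close>

lemma stein_2:
  "(\<integral>G. t1 G - e * t2 G \<partial>(gauss :: (real^'m^'n) measure))
    = (\<integral>G. real CARD('m) * t2 G - t1 G * (t1 G - e * t2 G) - t2 G * (trace P - e * t1 G) - 2 * (t2 G - e * t3 G) \<partial>(gauss :: (real^'m^'n) measure))"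
proof -
  define F' where "F' G b = R G ** dq G b + dR G b ** q G" for G b :: "real^'m^'n"
  have "(\<integral>G. (P ** G) \<bullet> (R G ** q G) \<partial>(gauss :: (real^'m^'n) measure)) = (\<integral>G. (\<Sum>b\<in>Basis. b \<bullet> F' G b) \<partial>(gauss :: (real^'m^'n) measure))"
  proof (rule gauss_stein_matrix)
    fix G b :: "real^'m^'n"
    show "((\<lambda>t. R (G + t *\<^sub>R (transpose P ** b)) ** q (G + t *\<^sub>R (transpose P ** b))) has_vector_derivative F' G b) (at 0)"
      using has_vector_derivative_matmul[OF R_derivative[of G b] q_derivative[of G b]] by (simp add: F'_def)
  qed (auto simp: F'_def intro!: pg_intros)
  moreover have "(P ** G) \<bullet> (R G ** q G) = t1 G - e * t2 G" for G :: "real^'m^'n"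
  proof -
    have "(P ** G) \<bullet> (R G ** q G) = (R G ** (P ** G)) \<bullet> q G"
      by (simp only: inner_mult_left R_sym)
    then show ?thesis by (simp add: matrix_mul_assoc q_def[symmetric] inner_qq)
  qed
  moreover have "(\<Sum>b\<in>Basis. b \<bullet> F' G b) = real CARD('m) * t2 G - t1 G * (t1 G - e * t2 G) - t2 G * (trace P - e * t1 G) - 2 * (t2 G - e * t3 G)"
    for G :: "real^'m^'n"
  proof -
    have "F' G b = (R G ** R G ** P) ** b ** mat 1 - (R G ** R G ** P) ** b ** (transpose (q G) ** (P ** G))
       - (R G ** q G) ** transpose b ** q G - (R G ** P) ** b ** (transpose (q G) ** q G) - q G ** transpose b ** (R G ** q G)" for b
    proof -
      have "P ** R G ** q G = R G ** (P ** q G)" by (simp add: PR matrix_mul_assoc)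
      then have "P ** R G ** q G = R G ** q G" by (simp only: Pq)
      then have *: "X ** P ** R G ** q G = X ** R G ** q G" for X :: "real^'n^'n" by (metis matrix_mul_assoc)
      have **: "X ** P ** R G ** P ** G = X ** q G" for X :: "real^'n^'n"
        by (simp add: q_def matrix_mul_assoc PR PR' PP')
      show ?thesis
        unfolding F'_def dq_def dR_def by (simp add: mat_simps matrix_mul_assoc * **)
    qed
    then have "(\<Sum>b\<in>Basis. b \<bullet> F' G b) = trace (R G ** R G ** P) * trace (mat 1 :: real^'m^'m)
      - trace (R G ** R G ** P) * trace (transpose (q G) ** (P ** G)) - (R G ** q G) \<bullet> q G
      - trace (R G ** P) * trace (transpose (q G) ** q G) - q G \<bullet> (R G ** q G)"
      by (simp only: inner_diff_right sum_subtractf sum_Basis_mult_mult sum_Basis_mult_transpose_mult)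
    then show ?thesis
      by (simp add: trace_I trace_gq inner_commute[of "R G ** q G"] inner_qRq t1_def[symmetric] t2_def[symmetric])
         (simp add: trace_eq_inner inner_qq)
  qed
  ultimately show ?thesis by simp
qed

text \<open>The vector field is \<open>t1 q\<close>; differentiating the scalar adds
  \<open>-2 q . (R q)\<close> to the divergence. For \<open>e = 0\<close> this gives
  \<open>(p - 1) E (t1^2) = k E t1 + 2 E t2\<close>, which closes the linear system.\<close>

lemma stein_3:
  "(\<integral>G. t1 G * (trace P - e * t1 G) \<partial>(gauss :: (real^'m^'n) measure))
    = (\<integral>G. t1 G * (real CARD('m) * t1 G - t1 G * (trace P - e * t1 G) - (t1 G - e * t2 G)) - 2 * (t2 G - e * t3 G) \<partial>(gauss :: (real^'m^'n) measure))"
proof -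
  define F' where "F' G b = t1 G *\<^sub>R dq G b + (- 2 * (b \<bullet> (R G ** q G))) *\<^sub>R q G" for G b :: "real^'m^'n"
  have "(\<integral>G. (P ** G) \<bullet> (t1 G *\<^sub>R q G) \<partial>(gauss :: (real^'m^'n) measure)) = (\<integral>G. (\<Sum>b\<in>Basis. b \<bullet> F' G b) \<partial>(gauss :: (real^'m^'n) measure))"
  proof (rule gauss_stein_matrix)
    fix G b :: "real^'m^'n"
    show "((\<lambda>t. t1 (G + t *\<^sub>R (transpose P ** b)) *\<^sub>R q (G + t *\<^sub>R (transpose P ** b))) has_vector_derivative F' G b) (at 0)"
      using bounded_bilinear.has_vector_derivative[OF bounded_bilinear_scaleR t1_derivative[of G b] q_derivative[of G b]]
      by (simp add: F'_def)
  qed (auto simp: F'_def intro!: pg_intros)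
  moreover have "(\<Sum>b\<in>Basis. b \<bullet> F' G b) = t1 G * (\<Sum>b\<in>Basis. b \<bullet> dq G b) - 2 * (t2 G - e * t3 G)"
    for G :: "real^'m^'n"
  proof -
    have "(\<Sum>b\<in>Basis. b \<bullet> F' G b) = t1 G * (\<Sum>b\<in>Basis. b \<bullet> dq G b) - 2 * (\<Sum>b\<in>Basis. (q G \<bullet> b) * ((R G ** q G) \<bullet> b))"
      by (simp add: F'_def inner_add_right inner_diff_right sum.distrib sum_distrib_left sum_negf sum_subtractf inner_commute mult_ac)
    then show ?thesis by (simp add: euclidean_inner[symmetric] inner_qRq)
  qed
  ultimately show ?thesis by (simp add: inner_gq div_q)
qed

text \<open>Turns an integral identity into an inequality by dropping a nonnegative remainder
  \<open>n\<close>, in the applications the terms carrying a factor \<open>e\<close>. Integrability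
  of \<open>n\<close> is inferred from the other functions.\<close>

lemma integral_eqD:
  assumes "(\<integral>G. f G \<partial>gauss) = (\<integral>G. g G \<partial>gauss)" "poly_growth f" "poly_growth g" "poly_growth h"
    "\<And>G. h G = (f G - g G) + n G" "\<And>G. (0::real) \<le> n G"
  shows "0 \<le> (\<integral>G. h G \<partial>gauss)"
proof -
  have "n = (\<lambda>G. h G - (f G - g G))" using assms(5) by (simp add: fun_eq_iff)
  moreover have "poly_growth (\<lambda>G. h G - (f G - g G))" using assms(2-4) by (intro pg_intros)
  ultimately have "poly_growth n" by (simp only:)
  then have n: "integrable gauss n" by (rule integrable_gauss)
  have "(\<integral>G. h G \<partial>gauss) = (\<integral>G. f G - g G \<partial>gauss) + (\<integral>G. n G \<partial>gauss)"
    unfolding assms(5)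
    by (intro Bochner_Integration.integral_add n integrable_gauss[OF poly_growth_diff] assms(2,3))
  also have "(\<integral>G. f G - g G \<partial>gauss) = 0"
    using assms(1-3) by (simp add: integrable_gauss)
  finally show ?thesis using assms(6) by (simp add: integral_nonneg)
qed

lemma trace_P_nonneg: "0 \<le> trace P"
  using psd_trace_nonneg[OF psd_gram[of P]] by (simp add: P_sym P_idem)

lemmas nonneg_intros = mult_nonneg_nonneg add_nonneg_nonneg t_nonneg zero_le_power2 zero_le_numeral less_imp_le[OF e_pos]

text \<open>For \<open>e = 0\<close> the three relations are equalities whose solution gives the
  exact inverse Wishart moments, so the constants do not suffer from the regularisation. The
  condition on \<open>p\<close> keeps all multipliers nonnegative and the final divisor
  positive.\<close>

lemma moment_bounds:
  fixes p :: real
  defines "p \<equiv> real CARD('m) - trace P"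
  defines "E \<equiv> (\<lambda>f. \<integral>G. f G \<partial>(gauss :: (real^'m^'n) measure))"
  assumes p: "4 \<le> p"
  shows "E t2 \<le> trace P * (trace P + p - 1) / (p * (p - 1) * (p - 3))"
    and "E (\<lambda>G. (t1 G)\<^sup>2) + E t2 \<le> trace P * ((p - 1) * (trace P + 1) + 2) / (p * (p - 1) * (p - 3))"
proof -
  define k where "k = trace P"
  define x where "x = E t1"
  define a where "a = E (\<lambda>G. (t1 G)\<^sup>2)"
  define b where "b = E t2"
  have k0: "0 \<le> k" unfolding k_def by (rule trace_P_nonneg)
  have m: "real CARD('m) = p + k" by (simp add: p_def k_def)
  have int: "integrable (gauss :: (real^'m^'n) measure) t1" "integrable (gauss :: (real^'m^'n) measure) t2"
     "integrable (gauss :: (real^'m^'n) measure) (\<lambda>G. (t1 G)\<^sup>2)"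
    by (intro integrable_gauss pg_intros)+
  have n1: "0 \<le> e * (t1 G + (t1 G)\<^sup>2 + t2 G)" for G :: "real^'m^'n"
    by (intro nonneg_intros)
  have "0 \<le> E (\<lambda>G. k - (p - 1) * t1 G)" unfolding E_def
    by (rule integral_eqD[OF stein_1 _ _ _ _ n1])
       (auto intro!: pg_intros simp: m k_def power2_eq_square algebra_simps)
  then have 1: "(p - 1) * x \<le> k"
    using int by (simp add: E_def x_def gauss.prob_space[simplified])
  have n2: "0 \<le> e * (2 * (t1 G * t2 G) + 2 * t3 G + t2 G)" for G :: "real^'m^'n"
    by (intro nonneg_intros)
  have "0 \<le> E (\<lambda>G. t1 G + (t1 G)\<^sup>2 - (p - 2) * t2 G)" unfolding E_def
    by (rule integral_eqD[OF stein_2 _ _ _ _ n2])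
       (auto intro!: pg_intros simp: m k_def power2_eq_square algebra_simps)
  then have 2: "(p - 2) * b \<le> x + a"
    using int by (simp add: E_def x_def a_def b_def)
  have n3: "0 \<le> e * ((t1 G)\<^sup>2 + t1 G * (t1 G)\<^sup>2 + t1 G * t2 G + 2 * t3 G)" for G :: "real^'m^'n"
    by (intro nonneg_intros)
  have "0 \<le> E (\<lambda>G. k * t1 G + 2 * t2 G - (p - 1) * (t1 G)\<^sup>2)" unfolding E_def
    by (rule integral_eqD[OF stein_3 _ _ _ _ n3])
       (auto intro!: pg_intros simp: m k_def power2_eq_square algebra_simps)
  then have 3: "(p - 1) * a \<le> k * x + 2 * b"
    using int by (simp add: E_def x_def a_def b_def)
  have pos: "p * (p - 1) * (p - 3) > 0" using p by simp
  have xk: "0 \<le> (k + p - 1) * (k - (p - 1) * x)" using 1 k0 p by simp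
  \<comment> \<open>Elimination of \<open>a\<close>; the determinant
    \<open>(p - 1)(p - 2) - 2 = p (p - 3)\<close> is the origin of the denominators of
    \<open>c1\<close> and \<open>c2\<close>.\<close>
  have "(p - 1) * ((p - 2) * b) \<le> (p - 1) * (x + a)"
    using 2 p by (intro mult_left_mono) auto
  then have b0: "(p * (p - 3)) * b \<le> (k + p - 1) * x"
    using 3 by (simp add: algebra_simps)
  then have "(p - 1) * ((p * (p - 3)) * b) \<le> (p - 1) * ((k + p - 1) * x)"
    using p by (intro mult_left_mono) auto
  then have b1: "(p * (p - 1) * (p - 3)) * b \<le> k * (k + p - 1)"
    using xk by (simp add: algebra_simps)
  then show "E t2 \<le> trace P * (trace P + p - 1) / (p * (p - 1) * (p - 3))"
    using pos by (simp add: b_def[symmetric] k_def[symmetric] pos_le_divide_eq mult_ac)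
  \<comment> \<open>Eliminating \<open>b\<close> instead produces the same determinant.\<close>
  have "(p - 2) * ((p - 1) * a) \<le> (p - 2) * (k * x + 2 * b)"
    using 3 p by (intro mult_left_mono) auto
  then have a0: "(p * (p - 3)) * a \<le> (k * (p - 2) + 2) * x"
    using 2 by (simp add: algebra_simps)
  have "(p * (p - 3)) * (a + b) \<le> (k * (p - 1) + p + 1) * x"
    using a0 b0 by (simp add: algebra_simps)
  then have "(p - 1) * ((p * (p - 3)) * (a + b)) \<le> (p - 1) * ((k * (p - 1) + p + 1) * x)"
    using p by (intro mult_left_mono) auto
  also have "\<dots> = (k * (p - 1) + p + 1) * ((p - 1) * x)" by (simp add: algebra_simps)
  also have "\<dots> \<le> (k * (p - 1) + p + 1) * k"
    using 1 k0 p by (intro mult_left_mono) auto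
  finally have "(p * (p - 1) * (p - 3)) * (a + b) \<le> k * ((p - 1) * (k + 1) + 2)"
    by (simp add: algebra_simps)
  then show "E (\<lambda>G. (t1 G)\<^sup>2) + E t2 \<le> trace P * ((p - 1) * (trace P + 1) + 2) / (p * (p - 1) * (p - 3))"
    using pos by (simp add: a_def[symmetric] b_def[symmetric] k_def[symmetric] pos_le_divide_eq mult_ac)
qed

section \<open>Fluctuations from the part of the Gaussian matrix orthogonal to
  \<open>P\<close>\<close>

definition Y :: "real^'n^'n \<Rightarrow> real^'m^'n \<Rightarrow> real^'n^'n" where
  "Y C G = C ** G ** transpose (q G)"

lemma poly_growth_Y [pg_intros]: "poly_growth (Y C)"
  unfolding Y_def[abs_def] by (intro pg_intros)

context
  fixes C :: "real^'n^'n"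
  assumes CP: "C ** P = 0"
begin

lemma P_line: "P ** (G + t *\<^sub>R (transpose C ** b)) = P ** G"
proof -
  have "P ** transpose C = transpose (C ** P)" by (simp add: mat_simps P_sym)
  then have "P ** transpose C = 0" by (simp add: CP transpose_0)
  then show ?thesis by (simp add: mat_simps matrix_mul_assoc matmul.zero_left)
qed

lemma q_line: "q (G + t *\<^sub>R (transpose C ** b)) = q G"
  by (simp add: q_def R_def W_def P_line flip: matrix_mul_assoc)

lemma Y_line: "((\<lambda>t. Y C (G + t *\<^sub>R (transpose C ** b))) has_vector_derivative C ** transpose C ** b ** transpose (q G)) (at 0)"
proof -
  have "Y C (G + t *\<^sub>R (transpose C ** b)) = Y C G + t *\<^sub>R (C ** transpose C ** b ** transpose (q G))" for t
    by (simp add: Y_def q_line mat_simps matrix_mul_assoc)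
  then show ?thesis by (simp add: has_vector_derivative_line)
qed

text \<open>\<open>Z\<close> depends on \<open>G\<close> only through \<open>P ** G\<close>, hence is constant along the directions used here.\<close>
lemma expectation_quadratic:
  fixes Z :: "real^'m^'n \<Rightarrow> real^'n^'n"
  assumes Z: "poly_growth Z" "\<And>G t b. Z (G + t *\<^sub>R (transpose C ** b)) = Z G"
  shows "(\<integral>G. (C ** G) \<bullet> (D ** Y C G ** Z G ** q G) \<partial>(gauss :: (real^'m^'n) measure))
    = (\<integral>G. trace (D ** C ** transpose C) * trace (transpose (q G) ** Z G ** q G) \<partial>(gauss :: (real^'m^'n) measure))"
proof -
  define F' where "F' G b = D ** (C ** transpose C ** b ** transpose (q G)) ** Z G ** q G" for G b :: "real^'m^'n"
  have "(\<integral>G. (C ** G) \<bullet> (D ** Y C G ** Z G ** q G) \<partial>(gauss :: (real^'m^'n) measure))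
    = (\<integral>G. (\<Sum>b\<in>Basis. b \<bullet> F' G b) \<partial>(gauss :: (real^'m^'n) measure))"
  proof (rule gauss_stein_matrix)
    fix G b :: "real^'m^'n"
    have "bounded_linear (\<lambda>X. D ** X ** Z G ** q G)"
      by (rule bounded_linear_compose[of "\<lambda>X. X ** q G"], rule bounded_bilinear.bounded_linear_left[OF bounded_bilinear_matrix_mult],
          rule bounded_linear_compose[of "\<lambda>X. X ** Z G"], rule bounded_bilinear.bounded_linear_left[OF bounded_bilinear_matrix_mult],
          rule bounded_bilinear.bounded_linear_right[OF bounded_bilinear_matrix_mult])
    from bounded_linear.has_vector_derivative[OF this Y_line[of G b]]
    show "((\<lambda>t. D ** Y C (G + t *\<^sub>R (transpose C ** b)) ** Z (G + t *\<^sub>R (transpose C ** b)) ** q (G + t *\<^sub>R (transpose C ** b)))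
      has_vector_derivative F' G b) (at 0)"
      by (simp add: F'_def q_line Z(2))
  qed (auto simp: F'_def intro!: pg_intros Z(1))
  moreover have "(\<Sum>b\<in>Basis. b \<bullet> F' G b) = trace (D ** C ** transpose C) * trace (transpose (q G) ** Z G ** q G)" for G
  proof -
    have "F' G b = (D ** C ** transpose C) ** b ** (transpose (q G) ** Z G ** q G)" for b
      by (simp add: F'_def matrix_mul_assoc)
    then show ?thesis by (simp only: sum_Basis_mult_mult)
  qed
  ultimately show ?thesis by simp
qed

text \<open>A matrix form of Wick's formula. For fixed \<open>P G\<close> the factor
  \<open>q\<close> is constant and \<open>C G\<close> is Gaussian, so the fourth moment of
  \<open>Y = C G q^T\<close> has three pairings, contributing \<open>(tr B)^2 |q q^T|^2\<close>,
  \<open>|B|^2 |q q^T|^2\<close> and \<open>|B|^2 |q|^4\<close>. Two integrations by parts take the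
  place of conditioning.\<close>

lemma expectation_quartic:
  fixes B :: "real^'n^'n"
  defines "B \<equiv> C ** transpose C"
  shows "(\<integral>G. (norm (Y C G ** transpose (Y C G)))\<^sup>2 \<partial>(gauss :: (real^'m^'n) measure))
    = (\<integral>G. ((trace B)\<^sup>2 + (norm B)\<^sup>2) * (norm (q G ** transpose (q G)))\<^sup>2 + (norm B)\<^sup>2 * (q G \<bullet> q G)\<^sup>2
         \<partial>(gauss :: (real^'m^'n) measure))"
proof -
  \<comment> \<open>Product rule for \<open>Y Y^T Y q\<close>: one summand per factor
    \<open>Y\<close>, as \<open>q\<close> is constant along these directions.\<close>
  define F' where "F' G b = B ** b ** (transpose (q G) ** transpose (Y C G) ** Y C G ** q G)
     + (Y C G ** q G) ** transpose b ** (B ** Y C G ** q G)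
     + (Y C G ** transpose (Y C G) ** B) ** b ** (transpose (q G) ** q G)" for G b :: "real^'m^'n"
  have B_sym: "transpose B = B" by (simp add: B_def mat_simps)
  have BB: "trace (B ** B) = (norm B)\<^sup>2"
    using trace_eq_inner[of B B] by (simp add: B_sym power2_norm_eq_inner)
  have qZq: "trace (transpose (q G) ** (q G ** transpose (q G)) ** q G) = (norm (q G ** transpose (q G)))\<^sup>2" for G :: "real^'m^'n"
  proof -
    have "trace (transpose (q G) ** (q G ** transpose (q G)) ** q G) = trace (transpose (q G) ** (q G ** transpose (q G) ** q G))"
      by (simp only: matrix_mul_assoc)
    also have "\<dots> = trace ((q G ** transpose (q G) ** q G) ** transpose (q G))" by (rule trace_mul_sym)
    also have "\<dots> = trace (transpose (q G ** transpose (q G)) ** (q G ** transpose (q G)))"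
      by (simp add: mat_simps matrix_mul_assoc)
    finally show ?thesis by (simp add: trace_eq_inner power2_norm_eq_inner)
  qed
  have "(norm (Y C G ** transpose (Y C G)))\<^sup>2 = (C ** G) \<bullet> (Y C G ** transpose (Y C G) ** Y C G ** q G)" for G :: "real^'m^'n"
  proof -
    have "(norm (Y C G ** transpose (Y C G)))\<^sup>2 = Y C G \<bullet> (Y C G ** transpose (Y C G) ** Y C G)"
      by (simp add: power2_norm_eq_inner inner_mult_right)
    also have "\<dots> = (C ** G ** transpose (q G)) \<bullet> (Y C G ** transpose (Y C G) ** Y C G)" 
      by (subst (1) Y_def) (rule refl)
    finally show ?thesis by (simp add: inner_mult_right)
  qed
  then have "(\<integral>G. (norm (Y C G ** transpose (Y C G)))\<^sup>2 \<partial>(gauss :: (real^'m^'n) measure))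
     = (\<integral>G. (C ** G) \<bullet> (Y C G ** transpose (Y C G) ** Y C G ** q G) \<partial>(gauss :: (real^'m^'n) measure))"
    by simp
  also have "\<dots> = (\<integral>G. (\<Sum>b\<in>Basis. b \<bullet> F' G b) \<partial>(gauss :: (real^'m^'n) measure))"
  proof (rule gauss_stein_matrix)
    fix G b :: "real^'m^'n"
    let ?Y = "\<lambda>t. Y C (G + t *\<^sub>R (transpose C ** b))"
    let ?D = "B ** b ** transpose (q G)"
    have Yd: "(?Y has_vector_derivative ?D) (at 0)" unfolding B_def by (rule Y_line)
    have "((\<lambda>t. ?Y t ** transpose (?Y t) ** ?Y t ** q G) has_vector_derivative
       (?Y 0 ** transpose (?Y 0) ** ?Y 0) ** 0 + (?Y 0 ** transpose (?Y 0) ** ?D + (?Y 0 ** transpose ?D + ?D ** transpose (?Y 0)) ** ?Y 0) ** q G) (at 0)"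
      by (intro has_vector_derivative_matmul has_vector_derivative_transpose Yd has_vector_derivative_const)
    then show "((\<lambda>t. ?Y t ** transpose (?Y t) ** ?Y t ** q (G + t *\<^sub>R (transpose C ** b))) has_vector_derivative F' G b) (at 0)"
      by (simp add: F'_def q_line mat_simps matrix_mul_assoc matmul.zero_right B_sym add_ac)
  qed (auto simp: F'_def intro!: pg_intros)
  \<comment> \<open>Each contraction is brought back to the form \<open>(C G) . (D Y Z q)\<close>,
    with \<open>(D, Z)\<close> equal to \<open>(I, q q^T)\<close>, \<open>(B, q q^T)\<close> and
    \<open>(B, |q|^2 I)\<close>, ready for the second integration by parts.\<close>
  also have "(\<lambda>G. \<Sum>b\<in>Basis. b \<bullet> F' G b) = (\<lambda>G :: real^'m^'n. trace B * ((C ** G) \<bullet> (mat 1 ** Y C G ** (q G ** transpose (q G)) ** q G))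
      + (C ** G) \<bullet> (B ** Y C G ** (q G ** transpose (q G)) ** q G)
      + (C ** G) \<bullet> (B ** Y C G ** ((q G \<bullet> q G) *\<^sub>R mat 1) ** q G))"
  proof
    fix G :: "real^'m^'n"
    have CG: "(C ** G) \<bullet> (X ** q G) = Y C G \<bullet> X" for X
      by (simp add: Y_def inner_mult_right)
    have "(\<Sum>b\<in>Basis. b \<bullet> F' G b) = trace B * trace (transpose (q G) ** transpose (Y C G) ** Y C G ** q G)
      + (Y C G ** q G) \<bullet> (B ** Y C G ** q G) + trace (Y C G ** transpose (Y C G) ** B) * trace (transpose (q G) ** q G)"
      by (simp only: F'_def inner_add_right sum.distrib sum_Basis_mult_mult sum_Basis_mult_transpose_mult)
    moreover have "trace (transpose (q G) ** transpose (Y C G) ** Y C G ** q G) = Y C G \<bullet> (Y C G ** (q G ** transpose (q G)))"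
    proof -
      have "trace (transpose (q G) ** transpose (Y C G) ** Y C G ** q G) = trace (transpose (Y C G ** q G) ** (Y C G ** q G))"
        by (simp add: mat_simps matrix_mul_assoc)
      also have "\<dots> = (Y C G ** q G) \<bullet> (Y C G ** q G)" by (rule trace_eq_inner)
      finally show ?thesis by (simp only: inner_mult_right matrix_mul_assoc)
    qed
    moreover have "(Y C G ** q G) \<bullet> (B ** Y C G ** q G) = Y C G \<bullet> (B ** Y C G ** (q G ** transpose (q G)))"
      by (simp add: inner_mult_right matrix_mul_assoc)
    moreover have "trace (Y C G ** transpose (Y C G) ** B) = Y C G \<bullet> (B ** Y C G)"
    proof -
      have "trace (Y C G ** transpose (Y C G) ** B) = trace (Y C G ** (transpose (Y C G) ** B))" by (simp only: matrix_mul_assoc)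
      also have "\<dots> = trace (transpose (Y C G) ** (B ** Y C G))" by (subst trace_mul_sym) (simp only: matrix_mul_assoc)
      finally show ?thesis by (simp only: trace_eq_inner)
    qed
    ultimately show "(\<Sum>b\<in>Basis. b \<bullet> F' G b) = trace B * ((C ** G) \<bullet> (mat 1 ** Y C G ** (q G ** transpose (q G)) ** q G))
      + (C ** G) \<bullet> (B ** Y C G ** (q G ** transpose (q G)) ** q G)
      + (C ** G) \<bullet> (B ** Y C G ** ((q G \<bullet> q G) *\<^sub>R mat 1) ** q G)"
      unfolding CG by (simp add: mat_simps trace_eq_inner)
  qed
  also have "(\<integral>G. trace B * ((C ** G) \<bullet> (mat 1 ** Y C G ** (q G ** transpose (q G)) ** q G))
      + (C ** G) \<bullet> (B ** Y C G ** (q G ** transpose (q G)) ** q G)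
      + (C ** G) \<bullet> (B ** Y C G ** ((q G \<bullet> q G) *\<^sub>R mat 1) ** q G) \<partial>(gauss :: (real^'m^'n) measure))
     = trace B * (\<integral>G. (C ** G) \<bullet> (mat 1 ** Y C G ** (q G ** transpose (q G)) ** q G) \<partial>(gauss :: (real^'m^'n) measure))
      + (\<integral>G. (C ** G) \<bullet> (B ** Y C G ** (q G ** transpose (q G)) ** q G) \<partial>(gauss :: (real^'m^'n) measure))
      + (\<integral>G. (C ** G) \<bullet> (B ** Y C G ** ((q G \<bullet> q G) *\<^sub>R mat 1) ** q G) \<partial>(gauss :: (real^'m^'n) measure))"
    by (subst Bochner_Integration.integral_add; (subst Bochner_Integration.integral_add)?; (subst Bochner_Integration.integral_mult_right)?; (intro integrable_gauss pg_intros)?; (rule refl)?)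
  also have "\<dots> = trace B * (\<integral>G. trace B * (norm (q G ** transpose (q G)))\<^sup>2 \<partial>(gauss :: (real^'m^'n) measure))
      + (\<integral>G. (norm B)\<^sup>2 * (norm (q G ** transpose (q G)))\<^sup>2 \<partial>(gauss :: (real^'m^'n) measure))
      + (\<integral>G. (norm B)\<^sup>2 * (q G \<bullet> q G)\<^sup>2 \<partial>(gauss :: (real^'m^'n) measure))"
  proof -
    have 1: "(\<integral>G. (C ** G) \<bullet> (D ** Y C G ** (q G ** transpose (q G)) ** q G) \<partial>(gauss :: (real^'m^'n) measure))
      = (\<integral>G. trace (D ** B) * (norm (q G ** transpose (q G)))\<^sup>2 \<partial>(gauss :: (real^'m^'n) measure))" for D
    proof (subst expectation_quadratic)
      show "(\<integral>G. trace (D ** C ** transpose C) * trace (transpose (q G) ** (q G ** transpose (q G)) ** q G) \<partial>(gauss :: (real^'m^'n) measure))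
        = (\<integral>G. trace (D ** B) * (norm (q G ** transpose (q G)))\<^sup>2 \<partial>(gauss :: (real^'m^'n) measure))"
        by (simp only: qZq) (simp only: B_def matrix_mul_assoc)
    qed (auto simp only: q_line intro!: pg_intros)
    have 2: "(\<integral>G. (C ** G) \<bullet> (B ** Y C G ** ((q G \<bullet> q G) *\<^sub>R mat 1) ** q G) \<partial>(gauss :: (real^'m^'n) measure))
      = (\<integral>G. (norm B)\<^sup>2 * (q G \<bullet> q G)\<^sup>2 \<partial>(gauss :: (real^'m^'n) measure))"
    proof (subst expectation_quadratic)
      show "(\<integral>G. trace (B ** C ** transpose C) * trace (transpose (q G) ** ((q G \<bullet> q G) *\<^sub>R mat 1) ** q G) \<partial>(gauss :: (real^'m^'n) measure))
        = (\<integral>G. (norm B)\<^sup>2 * (q G \<bullet> q G)\<^sup>2 \<partial>(gauss :: (real^'m^'n) measure))"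
      proof -
        have "trace (B ** C ** transpose C) = (norm B)\<^sup>2"
          unfolding BB[symmetric] by (simp add: B_def matrix_mul_assoc)
        then show ?thesis by (simp add: mat_simps trace_scaleR trace_eq_inner power2_eq_square)
      qed
    qed (auto simp only: q_line intro!: pg_intros)
    show ?thesis unfolding 1 2 by (simp add: BB)
  qed
  also have "\<dots> = (\<integral>G. ((trace B)\<^sup>2 + (norm B)\<^sup>2) * (norm (q G ** transpose (q G)))\<^sup>2 + (norm B)\<^sup>2 * (q G \<bullet> q G)\<^sup>2
         \<partial>(gauss :: (real^'m^'n) measure))"
  proof -
    have i: "integrable (gauss :: (real^'m^'n) measure) (\<lambda>G. (norm (q G ** transpose (q G)))\<^sup>2)"
      "integrable (gauss :: (real^'m^'n) measure) (\<lambda>G. (q G \<bullet> q G)\<^sup>2)"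
      by (intro integrable_gauss pg_intros)+
    show ?thesis using i by (simp add: power2_eq_square distrib_right)
  qed
  finally show ?thesis .
qed

end

end

subsection \<open>Bounds for the Nystrom error\<close>

text \<open>The error is dominated by a Gram matrix \<open>Z^T Z\<close>, whereas the cross terms of
  the trailing block cancel in \<open>Z Z^T\<close>; this allows a change of sides.\<close>

lemma norm_gram_swap: "norm (transpose Z ** Z) = norm (Z ** transpose Z)" for Z :: "real^'m^'n"
proof -
  have "(transpose Z ** Z) \<bullet> (transpose Z ** Z) = Z \<bullet> (Z ** transpose Z ** Z)"
    by (simp add: inner_mult_left matrix_mul_assoc)
  also have "\<dots> = (Z ** transpose Z) \<bullet> (Z ** transpose Z)"
    by (simp add: inner_mult_right)
  finally show ?thesis by (simp add: norm_eq_sqrt_inner)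
qed

lemma norm_orthogonal_conj:
  assumes "orthogonal_matrix U"
  shows "norm (U ** X ** transpose U) = norm (X :: real^'n^'n)"
proof -
  have U: "transpose U ** U = mat 1" using assms by (simp add: orthogonal_matrix)
  have *: "norm (U ** Z) = norm Z" for Z :: "real^'n^'n"
  proof -
    have "(U ** Z) \<bullet> (U ** Z) = Z \<bullet> (transpose U ** (U ** Z))" by (rule inner_mult_left)
    also have "\<dots> = Z \<bullet> Z" by (simp only: matrix_mul_assoc U matrix_mul_lid)
    finally show ?thesis by (simp add: norm_eq_sqrt_inner)
  qed
  have "norm (U ** X ** transpose U) = norm (U ** (X ** transpose U))" by (simp only: matrix_mul_assoc)
  also have "\<dots> = norm (transpose (X ** transpose U))" by (simp only: * norm_transpose)
  also have "\<dots> = norm (U ** transpose X)" by (simp only: matrix_transpose_mul transpose_transpose)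
  also have "\<dots> = norm X" by (simp only: * norm_transpose)
  finally show ?thesis .
qed

text \<open>By the parallelogram identity the gap is \<open>(A - B)(A - B)^T\<close>. This step
  creates the factors 2 in front of \<open>deltaF\<close> and the two \<open>beta\<close>
  terms.\<close>

lemma norm_gram_add_le:
  fixes A B :: "real^'m^'n"
  shows "norm ((A + B) ** transpose (A + B)) \<le> 2 * norm (A ** transpose A) + 2 * norm (B ** transpose B)"
proof -
  have "2 *\<^sub>R (A ** transpose A) + 2 *\<^sub>R (B ** transpose B) - (A + B) ** transpose (A + B) = (A - B) ** transpose (A - B)"
    by (simp add: mat_simps scaleR_2)
  then have "psd (2 *\<^sub>R (A ** transpose A) + 2 *\<^sub>R (B ** transpose B) - (A + B) ** transpose (A + B))"
    by (simp only: psd_gram')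
  then have "norm ((A + B) ** transpose (A + B)) \<le> norm (2 *\<^sub>R (A ** transpose A) + 2 *\<^sub>R (B ** transpose B))"
    by (rule psd_norm_mono[OF psd_gram'])
  also have "\<dots> \<le> norm (2 *\<^sub>R (A ** transpose A)) + norm (2 *\<^sub>R (B ** transpose B))" by (rule norm_triangle_ineq)
  finally show ?thesis by simp
qed

text \<open>Meant for a perturbation \<open>B\<close> of order \<open>e\<close>: the main term keeps
  the factor one, which the parallelogram bound would double.\<close>

lemma norm_gram_diff_le:
  fixes A B :: "real^'m^'n"
  shows "norm ((A - B) ** transpose (A - B)) \<le> norm (A ** transpose A) + 2 * (norm A * norm B) + (norm B)\<^sup>2"
proof -
  have "(A - B) ** transpose (A - B) = A ** transpose A - A ** transpose B - B ** transpose A + B ** transpose B"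
    by (simp add: mat_simps)
  then have "norm ((A - B) ** transpose (A - B)) \<le> norm (A ** transpose A) + norm (A ** transpose B) + norm (B ** transpose A) + norm (B ** transpose B)"
    using norm_triangle_ineq[of "A ** transpose A - A ** transpose B - B ** transpose A" "B ** transpose B"]
      norm_triangle_ineq4[of "A ** transpose A - A ** transpose B" "B ** transpose A"]
      norm_triangle_ineq4[of "A ** transpose A" "A ** transpose B"] by simp
  then show ?thesis
    using norm_mult_le[of A "transpose B"] norm_mult_le[of B "transpose A"] norm_mult_le[of B "transpose B"]
    by (simp add: power2_eq_square mult.commute)
qed

lemma norm_conj_le:
  fixes Y M :: "real^'n^'n"
  assumes "psd M" "psd (c *\<^sub>R mat 1 - M)" "0 \<le> c"
  shows "norm (Y ** M ** transpose Y) \<le> c * norm (Y ** transpose Y)"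
proof -
  have "psd (Y ** (c *\<^sub>R mat 1 - M) ** transpose Y)" by (rule psd_conj'[OF assms(2)])
  then have "psd (c *\<^sub>R (Y ** transpose Y) - Y ** M ** transpose Y)" by (simp add: mat_simps)
  then have "norm (Y ** M ** transpose Y) \<le> norm (c *\<^sub>R (Y ** transpose Y))"
    by (rule psd_norm_mono[OF psd_conj'[OF assms(1)]])
  then show ?thesis using assms(3) by simp
qed

text \<open>Nonnegativity of the variance.\<close>

lemma expectation_le_of_square:
  fixes f :: "real^'m^'n \<Rightarrow> real"
  assumes f: "poly_growth f" and sq: "(\<integral>G. (f G)\<^sup>2 \<partial>gauss) \<le> s\<^sup>2" and s: "0 \<le> s"
  shows "(\<integral>G. f G \<partial>gauss) \<le> s"
proof -
  define m where "m = (\<integral>G. f G \<partial>gauss)"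
  have i: "integrable gauss f" "integrable gauss (\<lambda>G. (f G)\<^sup>2)" by (intro integrable_gauss pg_intros f)+
  have "0 \<le> (\<integral>G. (f G - m)\<^sup>2 \<partial>gauss)" by simp
  also have "\<dots> = (\<integral>G. (f G)\<^sup>2 - 2 * m * f G + m\<^sup>2 \<partial>gauss)"
    by (simp add: power2_diff algebra_simps)
  also have "\<dots> = (\<integral>G. (f G)\<^sup>2 \<partial>gauss) - m\<^sup>2"
    using i by (simp add: m_def[symmetric] power2_eq_square gauss.prob_space[simplified])
  finally have "m\<^sup>2 \<le> s\<^sup>2" using sq by simp
  then show ?thesis using s unfolding m_def[symmetric] by (rule power2_le_imp_le)
qed

text \<open>\<open>nystrom A \<Omega> = H ** Q ** H\<close> for the orthogonal projection \<open>Q\<close> onto the range of \<open>H ** \<Omega>\<close>.\<close>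
lemma nystrom_norm_le:
  fixes H :: "real^'n^'n" and \<Omega> :: "real^'m^'n" and X :: "real^'n^'m"
  assumes H: "transpose H = H"
  shows "norm (H ** H - nystrom (H ** H) \<Omega>) \<le> norm (transpose (H - H ** \<Omega> ** X) ** (H - H ** \<Omega> ** X))"
proof -
  define T where "T = H ** \<Omega>"
  define N where "N = transpose T ** T"
  define Q where "Q = T ** pinv N ** transpose T"
  note pN = pinv_psd(1-3)[OF psd_gram[of T], folded N_def]
  have Q_sym: "transpose Q = Q" by (simp add: Q_def mat_simps pN matrix_mul_assoc)
  have QQ: "Q ** Q = Q"
  proof -
    have "Q ** Q = T ** (pinv N ** N ** pinv N) ** transpose T" by (simp add: Q_def N_def matrix_mul_assoc)
    then show ?thesis by (simp add: pN Q_def)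
  qed
  have QT: "Q ** T = T"
  proof -
    define Z where "Z = T ** pinv N ** N - T"
    have "transpose Z ** Z = (N ** pinv N - mat 1) ** (transpose T ** T) ** (pinv N ** N - mat 1)"
      by (simp add: Z_def mat_simps pN matrix_mul_assoc) (simp add: N_def mat_simps matrix_mul_assoc)
    also have "\<dots> = (N ** pinv N ** N - N) ** (pinv N ** N - mat 1)"
      unfolding N_def[symmetric] by (simp add: mat_simps)
    also have "\<dots> = 0" by (simp add: pN matmul.zero_left)
    finally have "Z = 0" by (rule gram_eq_0)
    then show ?thesis by (simp add: Z_def Q_def N_def matrix_mul_assoc)
  qed
  have ny: "nystrom (H ** H) \<Omega> = H ** Q ** H"
    by (simp add: nystrom_def Q_def N_def T_def mat_simps H matrix_mul_assoc)
  define Z where "Z = H - T ** X"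
  \<comment> \<open>\<open>I - Q\<close> annihilates \<open>T\<close>, so subtracting
    \<open>T X\<close> changes nothing; this is what leaves \<open>X\<close> free to be
    chosen.\<close>
  have QZ: "(mat 1 - Q) ** Z = (mat 1 - Q) ** H"
    by (simp add: Z_def mat_simps matrix_mul_assoc QT)
  have QQ1: "transpose (mat 1 - Q) ** (mat 1 - Q) = mat 1 - Q"
    by (simp add: mat_simps Q_sym QQ)
  have *: "transpose V ** (mat 1 - Q) ** V = transpose ((mat 1 - Q) ** V) ** ((mat 1 - Q) ** V)" for V :: "real^'n^'n"
  proof -
    have "transpose ((mat 1 - Q) ** V) ** ((mat 1 - Q) ** V) = transpose V ** (transpose (mat 1 - Q) ** (mat 1 - Q)) ** V"
      by (simp only: matrix_transpose_mul matrix_mul_assoc)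
    then show ?thesis by (simp only: QQ1)
  qed
  have E: "H ** H - nystrom (H ** H) \<Omega> = transpose H ** (mat 1 - Q) ** H"
    by (simp add: ny mat_simps H)
  also have "\<dots> = transpose Z ** (mat 1 - Q) ** Z" by (simp only: * QZ)
  finally have EZ: "H ** H - nystrom (H ** H) \<Omega> = transpose Z ** (mat 1 - Q) ** Z" .
  have "psd (H ** H - nystrom (H ** H) \<Omega>)" unfolding EZ * by (rule psd_gram)
  moreover have "transpose Z ** Z - (H ** H - nystrom (H ** H) \<Omega>) = transpose (Q ** Z) ** (Q ** Z)"
  proof -
    have "transpose (Q ** Z) ** (Q ** Z) = transpose Z ** (Q ** Q) ** Z"
      by (simp only: matrix_transpose_mul matrix_mul_assoc Q_sym)
    then show ?thesis by (simp add: EZ mat_simps QQ)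
  qed
  then have "psd (transpose Z ** Z - (H ** H - nystrom (H ** H) \<Omega>))" by (simp only: psd_gram)
  ultimately have "norm (H ** H - nystrom (H ** H) \<Omega>) \<le> norm (transpose Z ** Z)" by (rule psd_norm_mono)
  then show ?thesis by (simp only: Z_def T_def)
qed

section \<open>The mean fluctuation and the pointwise error bound\<close>

context ridge
begin

text \<open>After \<open>|q q^T|^2 \<le> t2\<close> and \<open>|q|^2 \<le> t1\<close>, the
  coefficient of \<open>(tr B)^2\<close> in the second moment is \<open>E t2\<close>, and that of
  \<open>|B|^2\<close> is \<open>E (t1^2) + E t2\<close>. This grouping explains the definitions of
  \<open>c2\<close> and \<open>c1\<close>.\<close>

lemma expectation_norm_Y:
  fixes C :: "real^'n^'n" and p c1 c2 :: real
  defines "p \<equiv> real CARD('m) - trace P"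
  defines "B \<equiv> C ** transpose C"
  defines "c1 \<equiv> trace P * ((p - 1) * (trace P + 1) + 2) / (p * (p - 1) * (p - 3))"
  defines "c2 \<equiv> trace P * (trace P + p - 1) / (p * (p - 1) * (p - 3))"
  assumes CP: "C ** P = 0" and p: "4 \<le> p"
  shows "(\<integral>G. norm (Y C G ** transpose (Y C G)) \<partial>(gauss :: (real^'m^'n) measure)) \<le> sqrt c1 * norm B + sqrt c2 * trace B"
proof (rule expectation_le_of_square)
  note mb = moment_bounds[where 'm='m, folded p_def, OF p, folded c1_def c2_def]
  have k0: "0 \<le> trace P" by (rule trace_P_nonneg)
  have c: "0 \<le> c1" "0 \<le> c2" unfolding c1_def c2_def using p k0
    by (auto intro!: divide_nonneg_nonneg mult_nonneg_nonneg add_nonneg_nonneg)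
  have trB: "0 \<le> trace B" unfolding B_def by (intro psd_trace_nonneg psd_gram')
  show "0 \<le> sqrt c1 * norm B + sqrt c2 * trace B" using c trB by simp
  show "poly_growth (\<lambda>G :: real^'m^'n. norm (Y C G ** transpose (Y C G)))" by (intro pg_intros)
  have int: "integrable (gauss :: (real^'m^'n) measure) (\<lambda>G. (t1 G)\<^sup>2)" "integrable (gauss :: (real^'m^'n) measure) t2"
    by (intro integrable_gauss pg_intros)+
  have qq2: "(q G \<bullet> q G)\<^sup>2 \<le> (t1 G)\<^sup>2" for G :: "real^'m^'n"
  proof (rule power_mono)
    show "q G \<bullet> q G \<le> t1 G" using mult_nonneg_nonneg[OF less_imp_le[OF e_pos] t_nonneg(2)] inner_qq[of G] by simp
  qed simp
  have "(\<integral>G. (norm (Y C G ** transpose (Y C G)))\<^sup>2 \<partial>(gauss :: (real^'m^'n) measure))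
    = (\<integral>G. ((trace B)\<^sup>2 + (norm B)\<^sup>2) * (norm (q G ** transpose (q G)))\<^sup>2 + (norm B)\<^sup>2 * (q G \<bullet> q G)\<^sup>2
         \<partial>(gauss :: (real^'m^'n) measure))"
    unfolding B_def by (rule expectation_quartic[OF CP])
  also have "\<dots> \<le> (\<integral>G. ((trace B)\<^sup>2 + (norm B)\<^sup>2) * t2 G + (norm B)\<^sup>2 * (t1 G)\<^sup>2 \<partial>(gauss :: (real^'m^'n) measure))"
    by (intro integral_mono integrable_gauss pg_intros add_mono mult_left_mono norm_qq qq2) auto
  also have "\<dots> = (trace B)\<^sup>2 * (\<integral>G. t2 G \<partial>(gauss :: (real^'m^'n) measure))
      + (norm B)\<^sup>2 * ((\<integral>G. (t1 G)\<^sup>2 \<partial>(gauss :: (real^'m^'n) measure)) + (\<integral>G. t2 G \<partial>(gauss :: (real^'m^'n) measure)))"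
    using int by (simp add: algebra_simps)
  also have "\<dots> \<le> (trace B)\<^sup>2 * c2 + (norm B)\<^sup>2 * c1"
    using mb by (intro add_mono mult_left_mono) auto
  also have "\<dots> \<le> (sqrt c1 * norm B + sqrt c2 * trace B)\<^sup>2"
    using c trB by (simp add: power2_sum power_mult_distrib mult_ac)
  finally show "(\<integral>G. (norm (Y C G ** transpose (Y C G)))\<^sup>2 \<partial>(gauss :: (real^'m^'n) measure))
     \<le> (sqrt c1 * norm B + sqrt c2 * trace B)\<^sup>2" .
qed

lemma gqR: "P ** G ** transpose (q G) = mat 1 - e *\<^sub>R R G"
proof -
  have "P ** G ** transpose (q G) = W G ** R G"
    by (simp add: q_def W_def mat_simps P_sym R_sym matrix_mul_assoc)
  then show ?thesis by (simp add: WR)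
qed

text \<open>The error bound for a fixed \<open>G\<close>, in the eigenbasis of \<open>A\<close>.
  \<open>S0\<close> projects onto the leading coordinates, \<open>T\<close> stands for
  \<open>U^T K^(1/2)\<close>, \<open>La\<close> is the pseudoinverse of \<open>L\<close>, and
  \<open>D1\<close>, \<open>D2\<close> are the two halves of the root of the eigenvalue matrix.
  \<open>M\<close> is \<open>I - \<Omega> X\<close> conjugated by \<open>U\<close>.\<close>

lemma core_bound:
  fixes T S0 Ki D1 D2 :: "real^'n^'n" and G :: "real^'m^'n"
  defines "L \<equiv> S0 ** T" and "N \<equiv> (mat 1 - S0) ** T"
  defines "La \<equiv> transpose L ** Ki"
  defines "M \<equiv> mat 1 - T ** G ** (transpose (q G) ** La)"
  defines "C \<equiv> D2 ** N ** (mat 1 - P)"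
  assumes S0: "transpose S0 = S0" "S0 ** S0 = S0" and Ki: "transpose Ki = Ki" "Ki ** S0 = Ki"
    and LLa: "L ** La = S0" and P: "P = La ** L"
    and D: "transpose D1 = D1" "transpose D2 = D2" "D1 ** S0 = D1" "D2 ** S0 = 0"
    and ka: "0 \<le> \<kappa>" "psd (\<kappa> *\<^sub>R mat 1 - La ** transpose La)" and e1: "e \<le> 1"
  shows "norm (transpose ((D1 + D2) ** M) ** ((D1 + D2) ** M)) \<le> norm (D2 ** D2)
     + 2 * norm ((D2 ** N ** La) ** transpose (D2 ** N ** La))
     + 2 * \<kappa> * norm (Y C G ** transpose (Y C G))
     + e * (((norm (D1 ** L))\<^sup>2 * (norm La)\<^sup>2
         + 4 * (norm (D2 ** N ** La) * (norm (D2 ** N) * norm La)) + 2 * (norm (D2 ** N))\<^sup>2 * (norm La)\<^sup>2) * (1 + t2 G))"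
proof -
  have S0D: "S0 ** D1 = D1" "S0 ** D2 = 0"
  proof -
    have "S0 ** D1 = transpose (D1 ** S0)" "S0 ** D2 = transpose (D2 ** S0)"
      by (simp_all only: matrix_transpose_mul S0(1) D(1,2))
    then show "S0 ** D1 = D1" "S0 ** D2 = 0" by (simp_all only: D transpose_0)
  qed
  have D12: "D1 ** D2 = 0" "D2 ** D1 = 0"
  proof -
    have "D1 ** S0 ** D2 = D1 ** (S0 ** D2)" "D2 ** S0 ** D1 = D2 ** (S0 ** D1)"
      by (simp_all only: matrix_mul_assoc)
    then show "D1 ** D2 = 0" "D2 ** D1 = 0"
      by (simp_all only: D S0D matmul.zero_left matmul.zero_right)
  qed
  have LaS: "La ** S0 = La" unfolding La_def by (simp add: Ki flip: matrix_mul_assoc)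
  have PLa: "P ** La = La" by (simp add: P LLa LaS flip: matrix_mul_assoc)
  have LP: "L ** P = L" unfolding P by (simp add: matrix_mul_assoc LLa) (simp add: L_def matrix_mul_assoc S0)
  \<comment> \<open>\<open>R\<close> alone may have size \<open>1/e\<close>, which would cancel the
    gain from the factor \<open>e\<close>; \<open>P La = La\<close> replaces it by
    \<open>R P\<close>, which \<open>t2\<close> controls.\<close>
  have RLa: "norm (R G ** La) \<le> norm La * sqrt (t2 G)"
  proof -
    have "R G ** La = R G ** P ** La" by (simp add: PLa flip: matrix_mul_assoc)
    then have "norm (R G ** La) \<le> norm (R G ** P) * norm La" by (simp only: norm_mult_le)
    also have "norm (R G ** P) = sqrt (t2 G)" using t2_norm[of G] by (metis norm_ge_zero real_sqrt_unique)
    finally show ?thesis by (simp add: mult.commute)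
  qed
  \<comment> \<open>With \<open>e \<le> 1\<close>, these crude bounds put every error term below a
    constant times \<open>e (1 + t2)\<close>, and the mean of \<open>t2\<close> is bounded uniformly
    in \<open>e\<close>.\<close>
  have s2: "sqrt (t2 G) \<le> 1 + t2 G" "(sqrt (t2 G))\<^sup>2 \<le> 1 + t2 G"
  proof -
    show "(sqrt (t2 G))\<^sup>2 \<le> 1 + t2 G" using t_nonneg(2)[of G] by simp
    have "t2 G \<le> (1 + t2 G)\<^sup>2" using t_nonneg(2)[of G] by (simp add: power2_eq_square algebra_simps)
    then show "sqrt (t2 G) \<le> 1 + t2 G" using t_nonneg(2)[of G] by (simp add: real_le_lsqrt)
  qed
  have s0: "0 \<le> sqrt (t2 G)" using t_nonneg(2)[of G] by simp

  \<comment> \<open>An exact right inverse of \<open>L G\<close> would give zero; the ridge leaves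
    the defect \<open>e R\<close>.\<close>
  have D1M: "D1 ** M = e *\<^sub>R (D1 ** L ** (R G ** La))"
  proof -
    have "D1 ** M = D1 ** (S0 ** M)" by (simp add: matrix_mul_assoc D)
    also have "S0 ** M = S0 - L ** G ** transpose (q G) ** La"
      by (simp add: M_def L_def mat_simps matrix_mul_assoc)
    also have "L ** G ** transpose (q G) ** La = L ** (P ** G ** transpose (q G)) ** La"
      by (simp add: matrix_mul_assoc LP)
    also have "S0 - \<dots> = e *\<^sub>R (L ** R G ** La)"
      unfolding gqR by (simp add: mat_simps LLa)
    finally show ?thesis by (simp add: mat_simps matrix_mul_assoc)
  qed
  define E where "E = D2 ** N ** (R G ** La)"
  define F where "F = (D2 ** N ** La - e *\<^sub>R E) + Y C G ** La"
  have D2M: "D2 ** M = D2 - F"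
  proof -
    have D2N: "D2 ** N = D2 ** T" by (simp add: N_def mat_simps matrix_mul_assoc D matmul.zero_left)
    have "D2 ** M = D2 - D2 ** N ** G ** transpose (q G) ** La"
      by (simp add: M_def mat_simps matrix_mul_assoc D2N)
    also have "D2 ** N ** G ** transpose (q G) = D2 ** N ** (P ** G ** transpose (q G)) + Y C G"
      by (simp add: Y_def C_def mat_simps matrix_mul_assoc)
    finally show ?thesis unfolding gqR by (simp add: F_def E_def mat_simps matrix_mul_assoc)
  qed
  have FD2: "F ** D2 = 0"
  proof -
    have "F ** S0 = F"
      unfolding F_def E_def by (simp add: mat_simps LaS flip: matrix_mul_assoc)
    then have "F ** D2 = F ** (S0 ** D2)" by (simp add: matrix_mul_assoc)
    then show ?thesis by (simp add: S0D matmul.zero_right)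
  qed
  have DF: "D2 ** transpose F = 0"
    using arg_cong[OF FD2, of transpose] by (simp add: mat_simps D transpose_0)
  \<comment> \<open>\<open>F\<close> has only leading columns and \<open>D2\<close> only trailing
    ones, so no cross terms remain and \<open>D2 D2\<close> keeps the factor one.\<close>
  have gram2: "(D2 ** M) ** transpose (D2 ** M) = D2 ** D2 + F ** transpose F"
    unfolding D2M by (simp add: mat_simps D FD2 DF)
  have "transpose ((D1 + D2) ** M) ** ((D1 + D2) ** M) = transpose M ** ((D1 + D2) ** (D1 + D2)) ** M"
    by (simp add: matrix_transpose_mul transpose_add D matrix_mul_assoc)
  also have "(D1 + D2) ** (D1 + D2) = D1 ** D1 + D2 ** D2" by (simp add: matmul.add_left matmul.add_right D12)
  also have "transpose M ** \<dots> ** M = transpose (D1 ** M) ** (D1 ** M) + transpose (D2 ** M) ** (D2 ** M)"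
    by (simp add: mat_simps D matrix_mul_assoc)
  finally have "norm (transpose ((D1 + D2) ** M) ** ((D1 + D2) ** M)) \<le>
     norm (transpose (D1 ** M) ** (D1 ** M)) + norm (transpose (D2 ** M) ** (D2 ** M))"
    by (simp only: norm_triangle_ineq)
  also have "norm (transpose (D2 ** M) ** (D2 ** M)) = norm (D2 ** D2 + F ** transpose F)"
    by (simp only: norm_gram_swap gram2)
  also have "norm (D2 ** D2 + F ** transpose F) \<le> norm (D2 ** D2) + norm (F ** transpose F)" by (rule norm_triangle_ineq)
  finally have 1: "norm (transpose ((D1 + D2) ** M) ** ((D1 + D2) ** M)) \<le>
     norm (transpose (D1 ** M) ** (D1 ** M)) + norm (D2 ** D2) + norm (F ** transpose F)" by simp
  have 2: "norm (transpose (D1 ** M) ** (D1 ** M)) \<le> e * ((norm (D1 ** L))\<^sup>2 * (norm La)\<^sup>2 * (1 + t2 G))"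
  proof -
    have "norm (transpose (D1 ** M) ** (D1 ** M)) \<le> (norm (D1 ** M))\<^sup>2"
      using norm_mult_le[of "transpose (D1 ** M)" "D1 ** M"] by (simp add: power2_eq_square)
    also have "\<dots> \<le> (e * (norm (D1 ** L) * (norm La * sqrt (t2 G))))\<^sup>2"
    proof (rule power_mono)
      have "norm (D1 ** M) = e * norm (D1 ** L ** (R G ** La))" using e_pos by (simp add: D1M)
      also have "\<dots> \<le> e * (norm (D1 ** L) * norm (R G ** La))"
        using e_pos by (intro mult_left_mono norm_mult_le) simp
      also have "\<dots> \<le> e * (norm (D1 ** L) * (norm La * sqrt (t2 G)))"
        using e_pos RLa by (intro mult_left_mono) auto
      finally show "norm (D1 ** M) \<le> e * (norm (D1 ** L) * (norm La * sqrt (t2 G)))" .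
    qed simp
    also have "\<dots> = e\<^sup>2 * ((norm (D1 ** L))\<^sup>2 * (norm La)\<^sup>2 * (sqrt (t2 G))\<^sup>2)"
      by (simp only: power_mult_distrib mult_ac)
    also have "\<dots> \<le> e * ((norm (D1 ** L))\<^sup>2 * (norm La)\<^sup>2 * (1 + t2 G))"
      using e_pos e1 s2 s0 t_nonneg(2)[of G] by (intro mult_mono mult_left_mono) (auto simp: power2_eq_square mult_left_le)
    finally show ?thesis .
  qed
  have Eb: "norm E \<le> norm (D2 ** N) * norm La * sqrt (t2 G)"
  proof -
    have "norm E \<le> norm (D2 ** N) * norm (R G ** La)" unfolding E_def by (rule norm_mult_le)
    also have "\<dots> \<le> norm (D2 ** N) * (norm La * sqrt (t2 G))" by (intro mult_left_mono RLa) simp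
    finally show ?thesis by (simp add: mult.assoc)
  qed
  have "norm (F ** transpose F) \<le> 2 * norm ((D2 ** N ** La - e *\<^sub>R E) ** transpose (D2 ** N ** La - e *\<^sub>R E))
      + 2 * norm ((Y C G ** La) ** transpose (Y C G ** La))"
    unfolding F_def by (rule norm_gram_add_le)
  moreover have "norm ((Y C G ** La) ** transpose (Y C G ** La)) \<le> \<kappa> * norm (Y C G ** transpose (Y C G))"
    using norm_conj_le[OF psd_gram'[of La] ka(2,1), of "Y C G"] by (simp add: matrix_transpose_mul matrix_mul_assoc)
  moreover have "norm ((D2 ** N ** La - e *\<^sub>R E) ** transpose (D2 ** N ** La - e *\<^sub>R E))
     \<le> norm ((D2 ** N ** La) ** transpose (D2 ** N ** La))
      + e * ((2 * (norm (D2 ** N ** La) * (norm (D2 ** N) * norm La)) + (norm (D2 ** N))\<^sup>2 * (norm La)\<^sup>2) * (1 + t2 G))"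
  proof -
    have "norm (D2 ** N ** La) * norm (e *\<^sub>R E) \<le> e * (norm (D2 ** N ** La) * (norm (D2 ** N) * norm La) * (1 + t2 G))"
    proof -
      have "norm (D2 ** N ** La) * norm (e *\<^sub>R E) = e * (norm (D2 ** N ** La) * norm E)" using e_pos by simp
      also have "\<dots> \<le> e * (norm (D2 ** N ** La) * (norm (D2 ** N) * norm La * sqrt (t2 G)))"
        using e_pos Eb by (intro mult_left_mono) auto
      also have "\<dots> \<le> e * (norm (D2 ** N ** La) * (norm (D2 ** N) * norm La * (1 + t2 G)))"
        using e_pos s2 by (intro mult_left_mono) auto
      finally show ?thesis by (simp add: mult_ac)
    qed
    moreover have "(norm (e *\<^sub>R E))\<^sup>2 \<le> e * ((norm (D2 ** N))\<^sup>2 * (norm La)\<^sup>2 * (1 + t2 G))"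
    proof -
      have "(norm (e *\<^sub>R E))\<^sup>2 = e\<^sup>2 * (norm E)\<^sup>2" by (simp add: power_mult_distrib)
      also have "\<dots> \<le> e * (norm E)\<^sup>2"
        using e_pos e1 by (intro mult_right_mono) (auto simp: power2_eq_square mult_left_le)
      also have "\<dots> \<le> e * (norm (D2 ** N) * norm La * sqrt (t2 G))\<^sup>2"
        using e_pos Eb by (intro mult_left_mono power_mono) auto
      also have "\<dots> \<le> e * ((norm (D2 ** N))\<^sup>2 * (norm La)\<^sup>2 * (1 + t2 G))"
        unfolding power_mult_distrib using e_pos s2 by (intro mult_left_mono) auto
      finally show ?thesis .
    qed
    ultimately show ?thesis
      using norm_gram_diff_le[of "D2 ** N ** La" "e *\<^sub>R E"] by (simp add: algebra_simps)
  qed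
  ultimately show ?thesis using 1 2 by (simp add: algebra_simps)
qed

end

subsection \<open>Coordinate blocks\<close>

lemma diag_mat_mult: "diag_mat f ** diag_mat g = diag_mat (\<lambda>i. f i * g i)"
proof -
  have "(diag_mat f ** diag_mat g) $ i $ j = diag_mat (\<lambda>i. f i * g i) $ i $ j" for i j
  proof -
    have "(diag_mat f ** diag_mat g) $ i $ j = (\<Sum>k\<in>UNIV. diag_mat f $ i $ k * diag_mat g $ k $ j)"
      by (simp add: matrix_matrix_mult_def)
    also have "\<dots> = (\<Sum>k\<in>UNIV. if k = i then f i * (if i = j then g i else 0) else 0)"
      by (intro sum.cong) (auto simp: diag_mat_def)
    finally show ?thesis by (simp add: diag_mat_def)
  qed
  then show ?thesis by (simp add: vec_eq_iff)
qed

lemma transpose_diag_mat: "transpose (diag_mat f) = diag_mat f"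
  by (auto simp: transpose_def diag_mat_def vec_eq_iff)

lemma diag_mat_add: "diag_mat f + diag_mat g = diag_mat (\<lambda>i. f i + g i)"
  by (auto simp: diag_mat_def vec_eq_iff)

lemma trace_diag_mat: "trace (diag_mat f) = (\<Sum>i\<in>UNIV. f i)"
  by (simp add: trace_def diag_mat_def)

lemma diag_mat_vec: "(diag_mat f *v x) $ i = f i * x $ i"
proof -
  have "(diag_mat f *v x) $ i = (\<Sum>k\<in>UNIV. diag_mat f $ i $ k * x $ k)"
    by (simp add: matrix_vector_mult_def)
  also have "\<dots> = (\<Sum>k\<in>UNIV. if k = i then f i * x $ i else 0)"
    by (intro sum.cong) (auto simp: diag_mat_def)
  finally show ?thesis by simp
qed

lemma psd_diag_mat: "(\<And>i. 0 \<le> f i) \<Longrightarrow> psd (diag_mat f)"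
proof (rule psdI)
  fix x assume f: "\<And>i. 0 \<le> f i"
  have "x \<bullet> (diag_mat f *v x) = (\<Sum>i\<in>UNIV. f i * (x $ i)\<^sup>2)"
    by (simp add: inner_vec_def diag_mat_vec power2_eq_square mult_ac)
  then show "0 \<le> x \<bullet> (diag_mat f *v x)" using f by (simp add: sum_nonneg)
qed (rule transpose_diag_mat)

lemma proj_sym: "transpose (proj S) = proj S"
  by (simp add: proj_def transpose_diag_mat)

lemma proj_idem: "proj S ** proj S = proj S"
  by (simp add: proj_def diag_mat_mult if_distrib cong: if_cong)

lemma proj_compl: "proj (- S) = mat 1 - proj S"
  by (auto simp: proj_def diag_mat_def mat_def vec_eq_iff)

lemma trace_proj: "trace (proj S) = real (card S)"
  by (simp add: proj_def trace_diag_mat sum.If_cases)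

lemma dim_range_proj_le: "dim (range ((*v) (proj S :: real^'n^'n))) \<le> card S"
proof -
  have "proj S *v x \<in> span ((\<lambda>i. axis i 1) ` S)" for x :: "real^'n"
  proof -
    have "proj S *v x = (\<Sum>i\<in>S. x $ i *\<^sub>R axis i 1)"
      by (auto simp: vec_eq_iff proj_def diag_mat_vec axis_def if_distrib[of "\<lambda>y. _ * y"] sum.delta cong: if_cong)
    also have "\<dots> \<in> span ((\<lambda>i. axis i 1) ` S)"
      by (intro span_sum span_scale span_base) auto
    finally show ?thesis .
  qed
  then have "range ((*v) (proj S :: real^'n^'n)) \<subseteq> span ((\<lambda>i. axis i 1) ` S)" by auto
  then have "dim (range ((*v) (proj S :: real^'n^'n))) \<le> card ((\<lambda>i. axis i 1 :: real^'n) ` S)"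
    by (rule dim_le_card) simp
  also have "\<dots> \<le> card S" by (rule card_image_le) simp
  finally show ?thesis .
qed

text \<open>The range of \<open>M\<close> lies in that of \<open>proj S\<close>, and the rank
  condition makes them equal. The pseudoinverse of the padded matrix is thus the padded inverse of
  the block.\<close>

lemma pinv_block:
  fixes M :: "real^'n^'n"
  assumes "psd M" "M = proj S ** M ** proj S" "rank M = card S"
  shows "M ** pinv M = proj S" "pinv M ** proj S = pinv M"
proof -
  have PM: "proj S ** M = M" and MP: "M ** proj S = M"
    using arg_cong[OF assms(2), of "\<lambda>X. proj S ** X"] arg_cong[OF assms(2), of "\<lambda>X. X ** proj S"] assms(2)
    by (simp_all add: matrix_mul_assoc proj_idem) (metis matrix_mul_assoc proj_idem)+
  have sub: "range ((*v) M) \<subseteq> range ((*v) (proj S))"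
    by (metis (no_types) PM image_subsetI matrix_vector_mul_assoc rangeI)
  have eq: "range ((*v) M) = range ((*v) (proj S))"
    using sub dim_range_proj_le[of S] assms(3)
    by (intro subspace_dim_equal) (auto intro!: linear_subspace_image simp: rank_dim_range)
  have "(M ** pinv M ** proj S) *v x = proj S *v x" for x
  proof -
    have "proj S *v x \<in> range ((*v) M)" unfolding eq by simp
    then obtain y where y: "proj S *v x = M *v y" by auto
    have "(M ** pinv M ** proj S) *v x = (M ** pinv M ** M) *v y"
      by (simp only: matrix_vector_mul_assoc[symmetric] y)
    then show ?thesis by (simp only: pinv_psd(1)[OF assms(1)] y)
  qed
  then have MYP: "M ** pinv M ** proj S = proj S" by (simp add: matrix_eq)
  have "M ** pinv M = pinv M ** (M ** proj S)" by (simp only: MP pinv_psd(4)[OF assms(1)])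
  also have "\<dots> = M ** pinv M ** proj S" by (simp only: matrix_mul_assoc pinv_psd(4)[OF assms(1)])
  finally show *: "M ** pinv M = proj S" by (simp only: MYP)
  have "pinv M ** (M ** pinv M) = pinv M" by (simp add: matrix_mul_assoc pinv_psd(2)[OF assms(1)])
  then show "pinv M ** proj S = pinv M" by (simp only: *)
qed

lemma spec_norm_nonneg: "0 \<le> spec_norm X"
  unfolding spec_norm_def by (rule onorm_pos_le) simp

text \<open>With \<open>y = X^T x\<close> and \<open>k\<close> the spectral norm of
  \<open>X^T X\<close>, two uses of Cauchy-Schwarz give
  \<open>|y|^4 \<le> |x|^2 |X y|^2 \<le> k |x|^2 |y|^2\<close>.\<close>

lemma psd_spec_norm_gram:
  fixes X :: "real^'m^'n"
  shows "psd (spec_norm (transpose X ** X) *\<^sub>R mat 1 - X ** transpose X)"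
proof (rule psdI)
  define k where "k = spec_norm (transpose X ** X)"
  have k0: "0 \<le> k" unfolding k_def by (rule spec_norm_nonneg)
  show "transpose (k *\<^sub>R mat 1 - X ** transpose X) = k *\<^sub>R mat 1 - X ** transpose X"
    by (simp add: mat_simps)
  fix x
  define y where "y = transpose X *v x"
  have 1: "y \<bullet> y = x \<bullet> (X *v y)"
    using inner_matvec_transpose[of X y x] by (simp add: y_def inner_commute)
  have "(norm (X *v y))\<^sup>2 = y \<bullet> ((transpose X ** X) *v y)"
    by (simp only: power2_norm_eq_inner inner_matvec_transpose matrix_vector_mul_assoc)
  also have "\<dots> \<le> norm y * norm ((transpose X ** X) *v y)" by (rule norm_cauchy_schwarz)
  also have "\<dots> \<le> norm y * (k * norm y)"
    unfolding k_def spec_norm_def by (intro mult_left_mono onorm) auto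
  finally have 2: "(norm (X *v y))\<^sup>2 \<le> k * (y \<bullet> y)" by (simp add: power2_norm_eq_inner[symmetric] power2_eq_square mult_ac)
  have "(y \<bullet> y)\<^sup>2 \<le> (norm x * norm (X *v y))\<^sup>2"
    unfolding 1 by (metis abs_ge_zero Cauchy_Schwarz_ineq2 power2_abs power_mono)
  also have "\<dots> \<le> (x \<bullet> x) * (k * (y \<bullet> y))"
    unfolding power_mult_distrib using 2 by (simp add: power2_norm_eq_inner[of x] mult_left_mono)
  finally have "(y \<bullet> y) * (y \<bullet> y) \<le> (k * (x \<bullet> x)) * (y \<bullet> y)" by (simp add: power2_eq_square mult_ac)
  then have "y \<bullet> y \<le> k * (x \<bullet> x)"
    using k0 by (metis inner_ge_zero mult_nonneg_nonneg mult_right_le_imp_le order_le_less)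
  moreover have "x \<bullet> ((k *\<^sub>R mat 1 - X ** transpose X) *v x) = k * (x \<bullet> x) - y \<bullet> y"
    by (simp add: matrix_vector_mult_diff_rdistrib scaleR_matrix_vector_assoc[symmetric] inner_diff_right 1)
       (simp add: y_def matrix_vector_mul_assoc del: transpose_matrix_vector)
  ultimately show "0 \<le> x \<bullet> ((k *\<^sub>R mat 1 - X ** transpose X) *v x)" by simp
qed

text \<open>The limit \<open>e -> 0\<close> is taken in the final numerical inequality, never under
  an integral.\<close>

lemma le_of_le_add_mult:
  fixes a b c :: real
  assumes "\<And>e. 0 < e \<Longrightarrow> e \<le> 1 \<Longrightarrow> a \<le> b + e * c"
  shows "a \<le> b"
proof (rule field_le_epsilon)
  fix d :: real assume d: "0 < d"
  define e where "e = min 1 (d / (\<bar>c\<bar> + 1))"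
  have e: "0 < e" "e \<le> 1" using d by (auto simp: e_def)
  have "e * c \<le> e * (\<bar>c\<bar> + 1)" using e by (intro mult_left_mono) auto
  also have "\<dots> \<le> d / (\<bar>c\<bar> + 1) * (\<bar>c\<bar> + 1)" by (intro mult_right_mono) (auto simp: e_def)
  also have "\<dots> = d" by simp
  finally show "a \<le> b + d" using assms[OF e] by simp
qed

text \<open>A Bochner integral of a non-integrable function is zero, so \<open>0 \<le> r\<close>
  settles the case of a non-measurable \<open>f\<close>. Measurability of the pseudoinverse
  therefore need not be examined.\<close>

lemma gauss_mat_integral_le:
  fixes f :: "real^'m^'n \<Rightarrow> real" and K :: "real^'n^'n"
  assumes "(\<integral>G. f (psd_sqrt K ** G) \<partial>(gauss :: (real^'m^'n) measure)) \<le> r" "0 \<le> r"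
  shows "(\<integral>\<Omega>. f \<Omega> \<partial>(gauss_mat K :: (real^'m^'n) measure)) \<le> r"
proof (cases "f \<in> borel_measurable borel")
  case True
  have "(\<lambda>G. psd_sqrt K ** G) \<in> borel_measurable (gauss :: (real^'m^'n) measure)"
    using poly_growth_borel[of "\<lambda>G :: real^'m^'n. psd_sqrt K ** G"] by (simp add: pg_intros)
  then show ?thesis using True assms(1)
    by (simp add: gauss_mat_def std_gauss_mat_eq integral_distr)
next
  case False
  then have "\<not> integrable (gauss_mat K :: (real^'m^'n) measure) f"
    by (auto simp: gauss_mat_def dest: borel_measurable_integrable)
  then show ?thesis using assms(2) by (simp add: not_integrable_integral_eq)
qed

theorem theorem2p5:
  fixes A K U :: "real^'n^'n" and \<sigma> :: "'n \<Rightarrow> real" and S :: "'n set"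
  assumes A_psd: "psd A"
    and U_orth: "orthogonal_matrix U"
    and A_eig: "A = U ** diag_mat \<sigma> ** transpose U"
    and \<sigma>_nonneg: "\<forall>i. 0 \<le> \<sigma> i"
    and S_top: "\<forall>i\<in>S. \<forall>j\<in>- S. \<sigma> j \<le> \<sigma> i"
    and k_ge: "2 \<le> card S" and k_le: "card S \<le> rank A"
    and p_ge: "card S + 4 \<le> CARD('m)"
    and K_psd: "psd K"
    and K11_inv: "rank (proj S ** (transpose U ** K ** U) ** proj S) = card S"
  shows
   "(let k = real (card S); p = real CARD('m) - real (card S);
         Kt = transpose U ** K ** U;
         K11i = pinv (proj S ** Kt ** proj S);
         K21 = proj (- S) ** Kt ** proj S;
         K22 = proj (- S) ** Kt ** proj (- S);
         K221 = K22 - K21 ** K11i ** transpose K21;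
         Sig2 = diag_mat (\<lambda>j. if j \<in> S then 0 else \<sigma> j);
         Sig2h = diag_mat (\<lambda>j. if j \<in> S then 0 else sqrt (\<sigma> j));
         betaF = fro_norm (Sig2h ** K221 ** Sig2h) / fro_norm Sig2 * spec_norm K11i;
         betaN = nuc_norm (Sig2h ** K221 ** Sig2h) / nuc_norm Sig2 * spec_norm K11i;
         deltaF = fro_norm (Sig2h ** K21 ** K11i ** K11i ** transpose K21 ** Sig2h) / fro_norm Sig2;
         c1 = k * ((p - 1) * (k + 1) + 2) / (p * (p - 1) * (p - 3));
         c2 = k * (k + p - 1) / (p * (p - 1) * (p - 3))
     in (\<integral>\<Omega>. fro_norm (A - nystrom A \<Omega>) \<partial>(gauss_mat K :: (real^'m^'n) measure))
        \<le> (1 + 2 * deltaF + 2 * sqrt c1 * betaF) * fro_norm Sig2 + 2 * sqrt c2 * betaN * nuc_norm Sig2)"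
proof -
  define k p where "k = real (card S)" and "p = real CARD('m) - real (card S)"
  define Kt where "Kt = transpose U ** K ** U"
  define K11 where "K11 = proj S ** Kt ** proj S"
  define K11i where "K11i = pinv K11"
  define K21 where "K21 = proj (- S) ** Kt ** proj S"
  define K22 where "K22 = proj (- S) ** Kt ** proj (- S)"
  define K221 where "K221 = K22 - K21 ** K11i ** transpose K21"
  define Sig2 where "Sig2 = diag_mat (\<lambda>j. if j \<in> S then 0 else \<sigma> j)"
  define Sig2h where "Sig2h = diag_mat (\<lambda>j. if j \<in> S then 0 else sqrt (\<sigma> j))"
  define D1 where "D1 = diag_mat (\<lambda>j. if j \<in> S then sqrt (\<sigma> j) else 0)"
  define B where "B = Sig2h ** K221 ** Sig2h"
  define De where "De = Sig2h ** K21 ** K11i ** K11i ** transpose K21 ** Sig2h"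
  define c1 where "c1 = k * ((p - 1) * (k + 1) + 2) / (p * (p - 1) * (p - 3))"
  define c2 where "c2 = k * (k + p - 1) / (p * (p - 1) * (p - 3))"
  define \<kappa> where "\<kappa> = spec_norm K11i"
  have \<kappa>: "0 \<le> \<kappa>" unfolding \<kappa>_def by (rule spec_norm_nonneg)
  have p4: "4 \<le> p" and k0: "0 \<le> k" using p_ge by (simp_all add: p_def k_def)
  have c_nonneg: "0 \<le> c1" "0 \<le> c2" unfolding c1_def c2_def using p4 k0
    by (auto intro!: divide_nonneg_nonneg mult_nonneg_nonneg add_nonneg_nonneg)

  define Kh where "Kh = psd_sqrt K"
  have Kh: "transpose Kh = Kh" "Kh ** Kh = K"
    unfolding Kh_def using psd_sqrt[OF K_psd] by (simp_all add: psd_sym)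
  define T where "T = transpose U ** Kh"
  have TT: "T ** transpose T = Kt"
  proof -
    have "T ** transpose T = transpose U ** (Kh ** Kh) ** U" by (simp add: T_def mat_simps Kh(1) matrix_mul_assoc)
    then show ?thesis by (simp add: Kh Kt_def)
  qed
  define L N where "L = proj S ** T" and "N = (mat 1 - proj S) ** T"
  have LL: "L ** transpose L = K11"
    unfolding L_def K11_def TT[symmetric] by (simp add: mat_simps proj_sym matrix_mul_assoc)
  have NL: "N ** transpose L = K21"
    unfolding L_def N_def K21_def proj_compl TT[symmetric] by (simp add: mat_simps proj_sym matrix_mul_assoc)
  have NN: "N ** transpose N = K22"
    unfolding L_def N_def K22_def proj_compl TT[symmetric] by (simp add: mat_simps proj_sym matrix_mul_assoc)
  have LN: "L ** transpose N = transpose K21"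
    unfolding NL[symmetric] by (simp add: mat_simps)
  have K11_psd: "psd K11" unfolding LL[symmetric] by (rule psd_gram')
  have K11_block: "K11 = proj S ** K11 ** proj S"
  proof -
    have "proj S ** K11 ** proj S = (proj S ** proj S) ** Kt ** (proj S ** proj S)"
      by (simp only: K11_def matrix_mul_assoc)
    then show ?thesis by (simp only: proj_idem K11_def)
  qed
  have K11i: "K11 ** K11i = proj S" "K11i ** proj S = K11i" "transpose K11i = K11i" "K11i ** K11 ** K11i = K11i"
    unfolding K11i_def using pinv_block[OF K11_psd K11_block] pinv_psd[OF K11_psd] K11_inv
    by (simp_all add: K11_def Kt_def)
  define La where "La = transpose L ** K11i"
  define P where "P = La ** L"
  have LLa: "L ** La = proj S" by (simp add: La_def matrix_mul_assoc LL K11i)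
  have LaS: "La ** proj S = La" by (simp add: La_def K11i flip: matrix_mul_assoc)
  have P_sym: "transpose P = P" by (simp add: P_def La_def mat_simps K11i matrix_mul_assoc)
  have P_idem: "P ** P = P"
  proof -
    have "P ** P = La ** (L ** La) ** L" by (simp only: P_def matrix_mul_assoc)
    then show ?thesis by (simp only: LLa LaS P_def)
  qed
  have trP: "trace P = k"
    unfolding P_def k_def trace_proj[symmetric] LLa[symmetric] by (rule trace_mul_sym)
  \<comment> \<open>\<open>La^T La\<close> is the padded inverse of the leading block, so its
    spectral norm \<open>\<kappa>\<close> also bounds \<open>La La^T\<close>.\<close>
  have \<kappa>La: "psd (\<kappa> *\<^sub>R mat 1 - La ** transpose La)"
  proof -
    have "transpose La ** La = K11i ** (L ** transpose L) ** K11i"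
      by (simp add: La_def mat_simps K11i matrix_mul_assoc)
    then have "transpose La ** La = K11i" by (simp only: LL K11i)
    then show ?thesis using psd_spec_norm_gram[of La] by (simp only: \<kappa>_def)
  qed

  have D: "transpose D1 = D1" "transpose Sig2h = Sig2h" "D1 ** proj S = D1" "Sig2h ** proj S = 0"
    "Sig2h ** Sig2h = Sig2" "D1 + Sig2h = diag_mat (\<lambda>i. sqrt (\<sigma> i))"
    using \<sigma>_nonneg
    by (auto simp: D1_def Sig2h_def Sig2_def proj_def transpose_diag_mat diag_mat_mult diag_mat_add)
       (auto simp: diag_mat_def vec_eq_iff)
  \<comment> \<open>\<open>I - P\<close> removes from the rows of \<open>Sig2h N\<close> their
    components in the row space of \<open>L\<close>; what remains has the scaled Schur complement as
    its Gram matrix.\<close>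
  define C where "C = Sig2h ** N ** (mat 1 - P)"
  have CP: "C ** P = 0" by (simp add: C_def mat_simps P_idem flip: matrix_mul_assoc)
  have CC: "C ** transpose C = B"
  proof -
    have "C ** transpose C = Sig2h ** (N ** ((mat 1 - P) ** (mat 1 - P)) ** transpose N) ** Sig2h"
      by (simp add: C_def matrix_transpose_mul transpose_diff P_sym D matrix_mul_assoc)
    also have "(mat 1 - P) ** (mat 1 - P) = mat 1 - P" by (simp add: mat_simps P_idem)
    also have "N ** (mat 1 - P) ** transpose N = N ** transpose N - (N ** transpose L) ** K11i ** (L ** transpose N)"
      by (simp add: mat_simps P_def La_def matrix_mul_assoc)
    finally show ?thesis by (simp only: NN NL LN B_def K221_def)
  qed
  have NLa: "Sig2h ** N ** La ** transpose (Sig2h ** N ** La) = De"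
  proof -
    have "Sig2h ** N ** La = Sig2h ** K21 ** K11i"
      by (simp add: La_def matrix_mul_assoc) (simp add: NL flip: matrix_mul_assoc)
    then show ?thesis by (simp add: De_def matrix_transpose_mul D K11i matrix_mul_assoc)
  qed
  have B_psd: "psd B" unfolding CC[symmetric] by (rule psd_gram')
  have Sig2_psd: "psd Sig2" unfolding Sig2_def using \<sigma>_nonneg by (intro psd_diag_mat) auto

  define H where "H = U ** (D1 + Sig2h) ** transpose U"
  have H_sym: "transpose H = H" by (simp add: H_def matrix_transpose_mul D(6) transpose_diag_mat matrix_mul_assoc)
  have HH: "H ** H = A"
  proof -
    have "H ** H = U ** (D1 + Sig2h) ** (transpose U ** U) ** (D1 + Sig2h) ** transpose U"
      by (simp only: H_def matrix_mul_assoc)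
    also have "transpose U ** U = mat 1" using U_orth by (simp add: orthogonal_matrix)
    also have "U ** (D1 + Sig2h) ** mat 1 ** (D1 + Sig2h) ** transpose U = U ** ((D1 + Sig2h) ** (D1 + Sig2h)) ** transpose U"
      by (simp only: matrix_mul_rid matrix_mul_assoc)
    also have "(D1 + Sig2h) ** (D1 + Sig2h) = diag_mat \<sigma>"
      unfolding D(6) diag_mat_mult using \<sigma>_nonneg by simp
    finally show ?thesis by (simp only: A_eig)
  qed

  \<comment> \<open>The claimed bound after the norms of \<open>Sig2\<close> have been cancelled
    against the denominators of the coefficients.\<close>
  define r where "r = norm Sig2 + 2 * norm De + 2 * \<kappa> * (sqrt c1 * norm B + sqrt c2 * trace B)"
  have r0: "0 \<le> r" unfolding r_def using \<kappa> c_nonneg psd_trace_nonneg[OF B_psd]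
    by (intro add_nonneg_nonneg mult_nonneg_nonneg) auto
  define c0 where "c0 = (norm (D1 ** L))\<^sup>2 * (norm La)\<^sup>2
         + 4 * (norm (Sig2h ** N ** La) * (norm (Sig2h ** N) * norm La)) + 2 * (norm (Sig2h ** N))\<^sup>2 * (norm La)\<^sup>2"
  have c0: "0 \<le> c0" unfolding c0_def by simp
  \<comment> \<open>The left side, \<open>r\<close>, \<open>c0\<close> and \<open>c2\<close> do not
    depend on \<open>e\<close>, so \<open>e\<close> may tend to zero afterwards.\<close>
  have main: "(\<integral>G. fro_norm (A - nystrom A (Kh ** G)) \<partial>(gauss :: (real^'m^'n) measure)) \<le> r + e * (c0 * (1 + c2))"
    if e: "0 < e" "e \<le> 1" for e
  proof -
    interpret ridge P e using P_sym P_idem e by unfold_locales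
    define b where "b G = norm Sig2 + 2 * norm De + 2 * \<kappa> * norm (Y C G ** transpose (Y C G)) + e * (c0 * (1 + t2 G))"
      for G :: "real^'m^'n"
    have pw: "fro_norm (A - nystrom A (Kh ** G)) \<le> b G" for G :: "real^'m^'n"
    proof -
      define M where "M = mat 1 - T ** G ** (transpose (q G) ** La)"
      \<comment> \<open>\<open>q^T La\<close> is the regularised right inverse of
        \<open>L G\<close>; the factor \<open>U^T\<close> makes \<open>Z\<close> a conjugate by
        \<open>U\<close> of a matrix in the eigenbasis.\<close>
      define X where "X = transpose (q G) ** La ** transpose U"
      define Z where "Z = H - H ** (Kh ** G) ** X"
      have Z: "Z = U ** ((D1 + Sig2h) ** M) ** transpose U"
        by (simp add: Z_def H_def X_def M_def T_def matmul.diff_left matmul.diff_right matrix_mul_assoc)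
      have "transpose Z ** Z = U ** (transpose ((D1 + Sig2h) ** M) ** ((D1 + Sig2h) ** M)) ** transpose U"
      proof -
        have "transpose Z ** Z = U ** transpose ((D1 + Sig2h) ** M) ** (transpose U ** U) ** ((D1 + Sig2h) ** M) ** transpose U"
          unfolding Z by (simp only: matrix_transpose_mul transpose_transpose matrix_mul_assoc)
        also have "transpose U ** U = mat 1" using U_orth by (simp add: orthogonal_matrix)
        finally show ?thesis by (simp only: matrix_mul_rid matrix_mul_assoc)
      qed
      then have "norm (transpose Z ** Z) = norm (transpose ((D1 + Sig2h) ** M) ** ((D1 + Sig2h) ** M))"
        by (simp only: norm_orthogonal_conj[OF U_orth])
      also have "\<dots> \<le> b G"
        unfolding b_def c0_def M_def
        using core_bound[of "proj S" K11i T D1 Sig2h \<kappa> G, folded L_def N_def, folded La_def, folded C_def]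
        by (simp only: proj_sym proj_idem K11i LLa P_def D \<kappa> \<kappa>La e NLa simp_thms)
      finally show ?thesis
        using nystrom_norm_le[OF H_sym, of "Kh ** G" X] by (simp only: fro_norm_eq HH Z_def)
    qed
    have "(\<integral>G. fro_norm (A - nystrom A (Kh ** G)) \<partial>(gauss :: (real^'m^'n) measure)) \<le> (\<integral>G. b G \<partial>gauss)"
    \<comment> \<open>Only the dominating function has to be integrable here.\<close>
    proof (rule integral_mono')
      show "integrable gauss b" unfolding b_def by (intro integrable_gauss pg_intros)
      show "0 \<le> b G" for G unfolding b_def using \<kappa> c0 e t_nonneg(2)[of G] by simp
    qed (rule pw)
    also have "\<dots> = norm Sig2 + 2 * norm De + 2 * \<kappa> * (\<integral>G. norm (Y C G ** transpose (Y C G)) \<partial>(gauss :: (real^'m^'n) measure))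
        + e * (c0 * (1 + (\<integral>G. t2 G \<partial>(gauss :: (real^'m^'n) measure))))"
    proof -
      have "integrable (gauss :: (real^'m^'n) measure) (\<lambda>G. norm (Y C G ** transpose (Y C G)))"
        "integrable (gauss :: (real^'m^'n) measure) t2"
        by (intro integrable_gauss pg_intros)+
      then show ?thesis by (simp add: b_def gauss.prob_space[simplified])
    qed
    also have "\<dots> \<le> norm Sig2 + 2 * norm De + 2 * \<kappa> * (sqrt c1 * norm B + sqrt c2 * trace B) + e * (c0 * (1 + c2))"
    proof -
      have "(\<integral>G. norm (Y C G ** transpose (Y C G)) \<partial>(gauss :: (real^'m^'n) measure)) \<le> sqrt c1 * norm B + sqrt c2 * trace B"
        using expectation_norm_Y[where 'm='m, OF CP] p4 by (simp add: trP CC c1_def c2_def p_def k_def)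
      moreover have "(\<integral>G. t2 G \<partial>(gauss :: (real^'m^'n) measure)) \<le> c2"
        using moment_bounds(1)[where 'm='m] p4 by (simp add: trP c2_def p_def k_def)
      ultimately show ?thesis using \<kappa> c0 e by (intro add_mono mult_left_mono order_refl) auto
    qed
    finally show ?thesis by (simp only: r_def)
  qed
  then have "(\<integral>G. fro_norm (A - nystrom A (Kh ** G)) \<partial>(gauss :: (real^'m^'n) measure)) \<le> r"
    by (rule le_of_le_add_mult)
  then have bound: "(\<integral>\<Omega>. fro_norm (A - nystrom A \<Omega>) \<partial>(gauss_mat K :: (real^'m^'n) measure)) \<le> r"
    unfolding Kh_def using r0 by (rule gauss_mat_integral_le)

  \<comment> \<open>For \<open>Sig2 = 0\<close> the quotients are zero by the convention on
    division; the cancellations below still hold because \<open>De\<close> and \<open>B\<close>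
    vanish as well.\<close>
  have degenerate: "Sig2 = 0 \<Longrightarrow> Sig2h = 0"
  proof -
    assume "Sig2 = 0"
    then have "transpose Sig2h ** Sig2h = 0" by (simp add: D)
    then show "Sig2h = 0" by (rule gram_eq_0)
  qed
  have F: "fro_norm De / fro_norm Sig2 * fro_norm Sig2 = norm De"
    "fro_norm B / fro_norm Sig2 * fro_norm Sig2 = norm B"
    "nuc_norm B / nuc_norm Sig2 * nuc_norm Sig2 = trace B"
  proof -
    have "De = 0 \<and> B = 0" if "Sig2 = 0"
      using degenerate[OF that] by (simp add: De_def B_def matmul.zero_right)
    then show "fro_norm De / fro_norm Sig2 * fro_norm Sig2 = norm De"
      "fro_norm B / fro_norm Sig2 * fro_norm Sig2 = norm B"
      "nuc_norm B / nuc_norm Sig2 * nuc_norm Sig2 = trace B"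
      using psd_trace_eq_0[OF Sig2_psd]
      by (auto simp: fro_norm_eq nuc_norm_psd B_psd Sig2_psd trace_def)
  qed
  have "r = (1 + 2 * (fro_norm De / fro_norm Sig2) + 2 * sqrt c1 * (fro_norm B / fro_norm Sig2 * \<kappa>)) * fro_norm Sig2
      + 2 * sqrt c2 * (nuc_norm B / nuc_norm Sig2 * \<kappa>) * nuc_norm Sig2"
  proof -
    have distrib: "(1 + 2 * x + 2 * a * (y * c)) * s + 2 * b * (z * c) * t
      = s + 2 * (x * s) + 2 * a * c * (y * s) + 2 * b * c * (z * t)" for x y z a b c s t :: real
      by (simp add: algebra_simps)
    show ?thesis unfolding distrib F by (simp add: r_def fro_norm_eq algebra_simps)
  qed
  with bound show ?thesis
    by (simp only: Let_def k_def p_def Kt_def K11_def K11i_def K21_def K22_def K221_def Sig2_def Sig2h_def B_def De_def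
        c1_def c2_def \<kappa>_def)
qed

end
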